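(* The bivariate map $T^{(2)}$ associated with the map $\chi$ has precisely two fixed points $\rho^{(2)}_1,\rho^{(2)}_2$ in $\mathcal P_\ast(I^2)_\rho$. For each $c\ge0$, let $f_c:[0,1]\to\mathbb R$ denote the continuous function given by the unique solution to the Cauchy problem $$\tfrac{\partial}{\partial r}f_c(r)=\frac{cr}{f_c(r)-r/2},\quad 0\le r<1,\qquad f_c(0)=\tfrac12.$$ The equation $f_c(1)^2-\tfrac12f_c(1)=2c$ is solved for precisely two values of $c$ in $[0,\infty)$. Denoting these by $c_1$ and $c_2$ with $c_1<c_2$, we have $c_1=0$ and $c_2\in(0,1/4)$. The measures $\rho^{(2)}_i$ $(i=1,2)$ are uniquely characterised by $$\rho^{(2)}_i\big(([0,r]\times I)\cup(I\times[0,s])\big)=(s\vee r)\,f_{c_i}\!\left(\frac{r\wedge s}{r\vee s}\right)\qquad\big((r,s)\in[0,1]^2\setminus\{(0,0)\}\big).$$ One has $\rho^{(2)}_1=\overline\rho^{(2)}$, where $\overline\rho^{(2)}$ is the law of $(Y,Y)$ with $Y$ distributed according to $\rho$.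
   Context: $I:=[0,1]\cup\{\infty\}$. $\rho$ is the probability measure on $I$ with $\rho([0,t])=\tfrac12t$ for $t\in[0,1]$ and $\rho(\{\infty\})=\tfrac12$. The map $\chi:[0,1]\times\{1,2\}\times I^2\to I$ is $$\chi[\tau,\kappa](x,y):=\begin{cases}x&\text{if }\kappa=1,\ x>\tau,\\ \infty&\text{if }\kappa=1,\ x\le\tau,\\ x\wedge y&\text{if }\kappa=2.\end{cases}$$ The bivariate map $T^{(2)}:\mathcal P(I^2)\to\mathcal P(I^2)$ (with $\mathcal P(\cdot)$ denoting probability measures) is: $T^{(2)}(\mu^{(2)})$ is the law of $\big(\chi[\tau,\kappa](Y_1,Y_2),\chi[\tau,\kappa](Y_1^*,Y_2^* )\big)$, where $(Y_1,Y_1^* ),(Y_2,Y_2^* )$ are i.i.d. with law $\mu^{(2)}$, $\tau$ is uniform on $[0,1]$, $\kappa$ is uniform on $\{1,2\}$, and $(Y_1,Y_1^* )$, $(Y_2,Y_2^* )$, $\tau$, $\kappa$ are independent. $\mathcal P_\ast(I^2)_\rho$ is the set of probability measures $\mu^{(2)}$ on $I^2$ that are symmetric under exchange of the two coordinates, whose one-dimensional marginals are both $\rho$, and that are scale invariant: $\mu^{(2)}([0,tr]\times[0,ts])=t\,\mu^{(2)}([0,r]\times[0,s])$ for all $r,s,t\in[0,1]$. *)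

theory Defs
  imports "HOL-Probability.Probability"
begin

definition I_set :: "ereal set" where
  "I_set = {0..1} \<union> {\<infinity>}"

definition I_meas :: "ereal measure" where
  "I_meas = restrict_space borel I_set"

(* The Borel sigma-algebra on the square of the state space; the probability measures on it
   are the elements of space (prob_algebra I2_meas). *)
definition I2_meas :: "(ereal \<times> ereal) measure" where
  "I2_meas = I_meas \<Otimes>\<^sub>M I_meas"

(* Pushforward of the uniform distribution on [0,2]: the half (1,2] is collapsed to the point
   at infinity. See rho_Icc, rho_infinity and rho_unique for the characterising properties. *)
definition rho :: "ereal measure" where
  "rho = distr (uniform_measure lborel {0..2::real}) I_meas
           (\<lambda>t. if 0 \<le> t \<and> t \<le> 1 then ereal t else \<infinity>)"

(* Only the values 1 and 2 of k occur. *)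
definition chi :: "real \<Rightarrow> nat \<Rightarrow> ereal \<Rightarrow> ereal \<Rightarrow> ereal" where
  "chi \<tau> k x y = (if k = 1 then (if x > ereal \<tau> then x else \<infinity>) else min x y)"

definition T2 :: "(ereal \<times> ereal) measure \<Rightarrow> (ereal \<times> ereal) measure" where
  "T2 \<mu> = distr ((uniform_measure lborel {0..1::real} \<Otimes>\<^sub>M uniform_count_measure {1, 2::nat})
                    \<Otimes>\<^sub>M (\<mu> \<Otimes>\<^sub>M \<mu>))
             I2_meas
             (\<lambda>((\<tau>, k), ((y1, y1'), (y2, y2'))). (chi \<tau> k y1 y2, chi \<tau> k y1' y2'))"

definition P_star_rho :: "(ereal \<times> ereal) measure set" where
  "P_star_rho = {\<mu> \<in> space (prob_algebra I2_meas).
     distr \<mu> I2_meas (\<lambda>(x, y). (y, x)) = \<mu> \<and>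
     distr \<mu> I_meas fst = rho \<and> distr \<mu> I_meas snd = rho \<and>
     (\<forall>r\<in>{0..1::real}. \<forall>s\<in>{0..1}. \<forall>t\<in>{0..1}.
        measure \<mu> ({0..ereal (t * r)} \<times> {0..ereal (t * s)})
          = t * measure \<mu> ({0..ereal r} \<times> {0..ereal s}))}"

definition rho_bar2 :: "(ereal \<times> ereal) measure" where
  "rho_bar2 = distr rho I2_meas (\<lambda>y. (y, y))"

(* Functions on [0,1] are represented by extensional functions, so that uniqueness is
   meaningful. The condition f r \<noteq> r / 2 says that the right-hand side of the differential
   equation is defined; without it, the convention x / 0 = 0 would change the problem. *)
definition cauchy_solution :: "real \<Rightarrow> (real \<Rightarrow> real) \<Rightarrow> bool" where
  "cauchy_solution c f \<longleftrightarrow>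
     f \<in> extensional {0..1} \<and> continuous_on {0..1} f \<and> f 0 = 1 / 2 \<and>
     (\<forall>r\<in>{0..<1}. f r \<noteq> r / 2 \<and>
        (f has_real_derivative (c * r / (f r - r / 2))) (at r within {0..1}))"

definition f_sol :: "real \<Rightarrow> real \<Rightarrow> real" where
  "f_sol c = (THE f. cauchy_solution c f)"

definition has_profile :: "(ereal \<times> ereal) measure \<Rightarrow> real \<Rightarrow> bool" where
  "has_profile \<mu> c \<longleftrightarrow>
     (\<forall>r\<in>{0..1}. \<forall>s\<in>{0..1}. (r, s) \<noteq> (0, 0) \<longrightarrow>
        measure \<mu> (({0..ereal r} \<times> I_set) \<union> (I_set \<times> {0..ereal s}))
          = max s r * f_sol c (min r s / max r s))"

lemma I_set_borel [measurable]: "I_set \<in> sets borel"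
  unfolding I_set_def by simp

lemma space_I_meas: "space I_meas = I_set"
  by (simp add: I_meas_def space_restrict_space)

lemma Icc_I_meas: "t \<le> 1 \<Longrightarrow> {0..ereal t} \<in> sets I_meas"
proof -
  assume "t \<le> 1"
  then have "ereal t \<le> 1" by (simp add: one_ereal_def)
  then have "{0..ereal t} \<subseteq> I_set" unfolding I_set_def using order_trans by fastforce
  then show ?thesis by (simp add: I_meas_def sets_restrict_space_iff)
qed

lemma infinity_I_meas: "{\<infinity>} \<in> sets I_meas"
  by (simp add: I_meas_def sets_restrict_space_iff I_set_def)

lemma rho_map_measurable:
  "(\<lambda>t. if 0 \<le> t \<and> t \<le> 1 then ereal t else \<infinity>) \<in> uniform_measure lborel {0..2::real} \<rightarrow>\<^sub>M I_meas"
  unfolding I_meas_def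
  by (rule measurable_restrict_space2) (auto simp: I_set_def one_ereal_def zero_ereal_def)

lemma prob_space_rho: "prob_space rho"
  unfolding rho_def
  by (rule prob_space.prob_space_distr[OF prob_space_uniform_measure rho_map_measurable]) auto

lemma sets_rho: "sets rho = sets I_meas"
  by (simp add: rho_def)

lemma rho_Icc:
  assumes "0 \<le> t" "t \<le> 1"
  shows "measure rho {0..ereal t} = t / 2"
proof -
  have "(\<lambda>t. if 0 \<le> t \<and> t \<le> 1 then ereal t else \<infinity>) -` {0..ereal t} = {0..t}"
    using assms by (auto simp: zero_ereal_def split: if_splits)
  moreover have "{0..2} \<inter> {0..t} = {0..t}" using assms by auto
  ultimately show ?thesis unfolding rho_def
    using assms
    by (subst measure_distr[OF rho_map_measurable Icc_I_meas])
       (simp_all add: measure_uniform_measure)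
qed

lemma rho_infinity: "measure rho {\<infinity>} = 1 / 2"
proof -
  have "(\<lambda>t. if 0 \<le> t \<and> t \<le> 1 then ereal t else \<infinity>) -` {\<infinity>} = - {0..1}"
    by (auto split: if_splits)
  moreover have "{0..2} \<inter> - {0..1} = {1<..2::real}" by auto
  ultimately show ?thesis unfolding rho_def
    by (subst measure_distr[OF rho_map_measurable infinity_I_meas])
       (simp_all add: measure_uniform_measure)
qed

lemma chi_in_I_set: "x \<in> I_set \<Longrightarrow> y \<in> I_set \<Longrightarrow> chi \<tau> k x y \<in> I_set"
  by (auto simp: chi_def I_set_def min_def)

lemma T2_map_measurable:
  assumes "sets \<mu> = sets I2_meas"
  shows "(\<lambda>((\<tau>, k), ((y1, y1'), (y2, y2'))). (chi \<tau> k y1 y2, chi \<tau> k y1' y2'))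
    \<in> ((uniform_measure lborel {0..1::real} \<Otimes>\<^sub>M uniform_count_measure {1, 2::nat})
         \<Otimes>\<^sub>M (\<mu> \<Otimes>\<^sub>M \<mu>)) \<rightarrow>\<^sub>M I2_meas"
proof -
  define N where "N = ((borel :: real measure) \<Otimes>\<^sub>M count_space {1, 2::nat})
    \<Otimes>\<^sub>M ((I_meas \<Otimes>\<^sub>M I_meas) \<Otimes>\<^sub>M (I_meas \<Otimes>\<^sub>M I_meas))"
  have eq: "sets ((uniform_measure lborel {0..1::real} \<Otimes>\<^sub>M uniform_count_measure {1, 2::nat})
         \<Otimes>\<^sub>M (\<mu> \<Otimes>\<^sub>M \<mu>)) = sets N"
    unfolding N_def
    by (intro sets_pair_measure_cong)
       (simp_all add: assms I2_meas_def sets_uniform_count_measure)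
  have id: "(\<lambda>x. x) \<in> I_meas \<rightarrow>\<^sub>M borel"
    unfolding I_meas_def by (rule measurable_restrict_space1) simp
  have [measurable]: "(\<lambda>w. fst (fst w)) \<in> borel_measurable N"
    "(\<lambda>w. snd (fst w)) \<in> N \<rightarrow>\<^sub>M count_space {1, 2}"
    unfolding N_def by measurable
  have y: "(\<lambda>w. fst (fst (snd w))) \<in> N \<rightarrow>\<^sub>M I_meas"
    "(\<lambda>w. snd (fst (snd w))) \<in> N \<rightarrow>\<^sub>M I_meas"
    "(\<lambda>w. fst (snd (snd w))) \<in> N \<rightarrow>\<^sub>M I_meas"
    "(\<lambda>w. snd (snd (snd w))) \<in> N \<rightarrow>\<^sub>M I_meas"
    unfolding N_def by measurable
  note [measurable] = y[THEN measurable_compose[OF _ id]]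
  have a: "(\<lambda>w. chi (fst (fst w)) (snd (fst w)) (fst (fst (snd w))) (fst (snd (snd w))))
      \<in> N \<rightarrow>\<^sub>M I_meas"
    unfolding I_meas_def
  proof (rule measurable_restrict_space2)
    show "(\<lambda>w. chi (fst (fst w)) (snd (fst w)) (fst (fst (snd w))) (fst (snd (snd w))))
      \<in> space N \<rightarrow> I_set"
      by (auto simp: N_def space_pair_measure space_I_meas intro!: chi_in_I_set)
  qed (simp add: chi_def)
  have b: "(\<lambda>w. chi (fst (fst w)) (snd (fst w)) (snd (fst (snd w))) (snd (snd (snd w))))
      \<in> N \<rightarrow>\<^sub>M I_meas"
    unfolding I_meas_def
  proof (rule measurable_restrict_space2)
    show "(\<lambda>w. chi (fst (fst w)) (snd (fst w)) (snd (fst (snd w))) (snd (snd (snd w))))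
      \<in> space N \<rightarrow> I_set"
      by (auto simp: N_def space_pair_measure space_I_meas intro!: chi_in_I_set)
  qed (simp add: chi_def)
  show ?thesis
    unfolding measurable_cong_sets[OF eq refl] I2_meas_def
    using measurable_Pair[OF a b] by (simp add: case_prod_unfold)
qed

lemma T2_in_prob_algebra:
  assumes "\<mu> \<in> space (prob_algebra I2_meas)"
  shows "T2 \<mu> \<in> space (prob_algebra I2_meas)"
proof -
  have s: "sets \<mu> = sets I2_meas" and p: "prob_space \<mu>"
    using assms by (auto simp: space_prob_algebra)
  interpret m: prob_space \<mu> by (rule p)
  interpret mm: pair_prob_space \<mu> \<mu> ..
  interpret u: prob_space "uniform_measure lborel {0..1::real}"
    by (rule prob_space_uniform_measure) auto
  interpret k: prob_space "uniform_count_measure {1, 2::nat}"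
    by (rule prob_space_uniform_count_measure) auto
  interpret uk: pair_prob_space "uniform_measure lborel {0..1::real}"
    "uniform_count_measure {1, 2::nat}" ..
  interpret w: pair_prob_space
    "uniform_measure lborel {0..1::real} \<Otimes>\<^sub>M uniform_count_measure {1, 2::nat}"
    "\<mu> \<Otimes>\<^sub>M \<mu>" ..
  show ?thesis
    unfolding T2_def
    using w.P.prob_space_distr[OF T2_map_measurable[OF s]]
    by (simp add: space_prob_algebra del: One_nat_def)
qed

lemma rho_unique:
  assumes "prob_space M" "sets M = sets I_meas"
    and "\<And>t. 0 \<le> t \<Longrightarrow> t \<le> 1 \<Longrightarrow> measure M {0..ereal t} = t / 2"
    and "measure M {\<infinity>} = 1 / 2"
  shows "M = rho"
proof -
  interpret M: prob_space M by fact
  interpret R: prob_space rho by (rule prob_space_rho)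
  define M' where "M' = distr M borel (\<lambda>x. x)"
  define R' where "R' = distr rho borel (\<lambda>x. x)"
  have id: "(\<lambda>x. x) \<in> I_meas \<rightarrow>\<^sub>M borel"
    unfolding I_meas_def by (rule measurable_restrict_space1) simp
  have idM [measurable]: "(\<lambda>x. x) \<in> M \<rightarrow>\<^sub>M borel" "(\<lambda>x. x) \<in> rho \<rightarrow>\<^sub>M borel"
    using id by (simp_all add: measurable_cong_sets[OF assms(2) refl]
        measurable_cong_sets[OF sets_rho refl])
  have sp: "space M = I_set" "space rho = I_set"
    using sets_eq_imp_space_eq[OF assms(2)] sets_eq_imp_space_eq[OF sets_rho]
    by (simp_all add: space_I_meas)
  have half: "emeasure M ({..a} \<inter> I_set) = emeasure rho ({..a} \<inter> I_set)" for a
  proof -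
    consider "a < 0" | t where "a = ereal t" "0 \<le> t" "t \<le> 1" | "1 < a" "a < \<infinity>" | "a = \<infinity>"
      by (cases a) (auto simp: one_ereal_def zero_ereal_def, force)
    then show ?thesis
    proof cases
      case 1
      then have "{..a} \<inter> I_set = {}" by (auto simp: I_set_def)
      then show ?thesis by simp
    next
      case 2
      then have "{..a} \<inter> I_set = {0..ereal t}"
        by (auto simp: I_set_def one_ereal_def intro: order_trans)
      then show ?thesis using assms(3)[OF 2(2,3)] rho_Icc[OF 2(2,3)]
        by (simp add: M.emeasure_eq_measure R.emeasure_eq_measure)
    next
      case 3
      then have "{..a} \<inter> I_set = {0..ereal 1}"
        by (auto simp: I_set_def one_ereal_def intro: order_trans less_imp_le)
      then show ?thesis using assms(3)[of 1] rho_Icc[of 1]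
        by (simp add: M.emeasure_eq_measure R.emeasure_eq_measure)
    next
      case 4
      then have "{..a} \<inter> I_set = I_set" by auto
      then show ?thesis using M.emeasure_space_1 R.emeasure_space_1 sp by simp
    qed
  qed
  have B: "sets borel = sigma_sets UNIV (range (atMost :: ereal \<Rightarrow> _))"
  proof -
    have "borel = sigma UNIV (range (atMost :: ereal \<Rightarrow> _))"
    proof (rule borel_eq_sigmaI1[OF borel_Ioi[where 'a=ereal]])
      show "X \<in> sets (sigma UNIV (range (atMost :: ereal \<Rightarrow> _)))"
        if X: "X \<in> range greaterThan" for X
      proof -
        obtain a where a: "X = {a<..}" using X by auto
        have "X = space (sigma UNIV (range (atMost :: ereal \<Rightarrow> _))) - {..a}"
          by (auto simp: a)
        then show ?thesis by (simp only:) (rule sets.compl_sets, simp)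
      qed
    qed auto
    then show ?thesis by (metis sets_measure_of top_greatest Pow_UNIV)
  qed
  have "emeasure M A = emeasure rho A" if A: "A \<in> sets I_meas" for A
  proof -
    have "M' = R'"
    proof (rule measure_eqI_generator_eq[where \<Omega>=UNIV and E="range atMost" and A="\<lambda>_. {..\<infinity>}"])
      show "Int_stable (range (atMost :: ereal \<Rightarrow> _))"
        by (auto simp: Int_stable_def Int_atMost)
      show "sets M' = sigma_sets UNIV (range atMost)" "sets R' = sigma_sets UNIV (range atMost)"
        unfolding M'_def R'_def by (simp_all add: B)
      show "emeasure M' X = emeasure R' X" if "X \<in> range atMost" for X
        using that half by (auto simp: M'_def R'_def emeasure_distr sp)
      show "emeasure M' {..\<infinity>} \<noteq> \<infinity>" for i :: nat
        by (simp add: M'_def emeasure_distr M.emeasure_eq_measure)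
    qed auto
    moreover have "A \<in> sets borel" "A \<subseteq> I_set"
      using A by (auto simp: I_meas_def sets_restrict_space_iff)
    then have "emeasure M' A = emeasure M A" "emeasure R' A = emeasure rho A"
      by (simp_all add: M'_def R'_def emeasure_distr sp Int_absorb2)
    ultimately show ?thesis by simp
  qed
  then show ?thesis using assms(2) sets_rho by (intro measure_eqI) auto
qed

end

theory Submission
  imports Defs
begin

text \<open>
  A measure in the class considered is determined by its values
  F(r,s) on the corner sets [0,r] x I union I x [0,s], and scale invariance reduces F to the
  profile f(x) = F(1,x), namely F(r,s) = r f(s/r) for s \<le> r. Computing F for the image under
  the bivariate map turns the fixed point equation into
  f(x)^2 - x f(x) = 1/4 - integral of f over [0,x] + c x^2 with
  c = 1/4 - integral of f over [0,1] + f(1)/2. Differentiating gives the Cauchy problem, and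
  taking x = 1 gives the end condition on f(1).

  With c = p q and q = p + 1/2 the Cauchy problem is linear in a suitable time t, where r' = f - r/2
  and f' = c r; hence f + p r = exp(p t)/2 and f - q r = exp(- q t)/2. If T is the time at which
  r = 1, the end condition for c > 0 reads exp(- T/2) = 4 c. Written in terms of a = 2 p this is a
  root of a function that is strictly concave on (0,\<infinity>), vanishes at 0+ and is positive near 0,
  so there is exactly one such root.

  At that value of c one has 2 f'(1) = f(1), which is exactly the absence of mass on the
  diagonal, and f'' \<ge> 0. The second fixed point is then obtained by placing the smaller coordinate
  uniformly on [0,1] and letting the ratio of the two coordinates have density f''.
\<close>

section \<open>The Cauchy problem\<close>

text \<open>Corner sets have products as complements. Two independent pairs both miss a corner with
  probability (1 - F)^2, so the fixed point equation F = G/2 + (1 - (1 - F)^2)/2 collapses to F^2 =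
  G, where G is the part with \<open>k = 1\<close>, averaged over \<tau>. All corners contain the
  axes \<open>corner 0 0\<close>; mass inside the axes is invisible to them, so the axes must be
  null before corners determine a measure.

  At r = 1 the Cauchy problem may degenerate: for c = 0 the solution meets r/2 there. Uniqueness
  therefore rests on monotonicity, the right-hand side being nonincreasing in f, and not on a
  Lipschitz bound. The exponents p and - q are the eigenvalues of the linear system, the roots of
  \<lambda>^2 + \<lambda>/2 = c.

  The end condition acts twice. It identifies c with the constant in the integral equation, and
  because f'(1) = c / (f(1) - 1/2) it says 2 f'(1) = f(1). The bound c < 1/4 serves the construction
  too: it gives f(1) \<le> 1, so that the mass 1 - f(1) left for (\<infinity>,\<infinity>) is not
  negative.\<close>

lemma cauchy_solution_gt_half:
  assumes f: "cauchy_solution c f" and r: "0 \<le> r" "r < 1"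
  shows "r / 2 < f r"
proof (rule ccontr)
  assume "\<not> r / 2 < f r"
  moreover have "continuous_on {0..r} (\<lambda>x. f x - x / 2)"
    using f r by (auto simp: cauchy_solution_def intro!: continuous_intros elim: continuous_on_subset)
  ultimately obtain x where "0 \<le> x" "x \<le> r" "f x - x / 2 = 0"
    using IVT2'[of "\<lambda>x. f x - x / 2" r 0 0] f r by (auto simp: cauchy_solution_def)
  then show False using f r by (auto simp: cauchy_solution_def)
qed

text \<open>For c \<ge> 0 the right-hand side is nonincreasing in f where f > r/2, so the squared
  difference of two solutions cannot grow. Derivatives are inspected only in the open interval;
  continuity carries the conclusion to x = 1, where the equation is not imposed.\<close>

lemma cauchy_solution_unique:
  assumes c: "0 \<le> c" and f: "cauchy_solution c f" and g: "cauchy_solution c g"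
  shows "f = g"
proof (rule extensionalityI[of f "{0..1}" g])
  show "f \<in> extensional {0..1}" "g \<in> extensional {0..1}"
    using f g by (auto simp: cauchy_solution_def)
  fix x :: real assume x: "x \<in> {0..1}"
  have "(f x - g x)\<^sup>2 \<le> (f 0 - g 0)\<^sup>2"
  proof (rule DERIV_nonpos_imp_decreasing_open[where f="\<lambda>x. (f x - g x)\<^sup>2"])
    show "0 \<le> x" using x by simp
    show "continuous_on {0..x} (\<lambda>x. (f x - g x)\<^sup>2)"
      using f g x by (auto simp: cauchy_solution_def intro!: continuous_intros elim: continuous_on_subset)
    fix r assume r: "0 < r" "r < x"
    then have r1: "r < 1" using x by simp
    have gt: "r / 2 < f r" "r / 2 < g r"
      using cauchy_solution_gt_half[OF f] cauchy_solution_gt_half[OF g] r r1 by auto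
    have at: "at r within {0..1} = at r" using r r1 by (simp add: at_within_Icc_at)
    have df: "(f has_real_derivative (c * r / (f r - r / 2))) (at r)"
      and dg: "(g has_real_derivative (c * r / (g r - r / 2))) (at r)"
      using f g r r1 by (auto simp: cauchy_solution_def at[symmetric])
    define D where "D = 2 * (f r - g r) * (c * r / (f r - r / 2) - c * r / (g r - r / 2))"
    have "((\<lambda>x. (f x - g x)\<^sup>2) has_real_derivative D) (at r)"
      unfolding D_def by (auto intro!: derivative_eq_intros df dg)
    moreover have "D = - (2 * c * r * (f r - g r)\<^sup>2 / ((f r - r / 2) * (g r - r / 2)))"
    proof -
      have "c * r / (f r - r / 2) - c * r / (g r - r / 2)
        = - (c * r * (f r - g r)) / ((f r - r / 2) * (g r - r / 2))"
        using gt by (subst diff_frac_eq) (auto simp: algebra_simps)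
      then show ?thesis unfolding D_def power2_eq_square
        by (simp only: times_divide_eq_right mult_minus_right minus_divide_left mult_ac)
    qed
    moreover have "0 \<le> 2 * c * r * (f r - g r)\<^sup>2 / ((f r - r / 2) * (g r - r / 2))"
      using gt c r by (intro divide_nonneg_nonneg mult_nonneg_nonneg) auto
    ultimately show "\<exists>y. ((\<lambda>x. (f x - g x)\<^sup>2) has_real_derivative y) (at r) \<and> y \<le> 0"
      by (intro exI[of _ D]) simp
  qed
  moreover have "f 0 = g 0" using f g unfolding cauchy_solution_def by metis
  ultimately show "f x = g x" by simp
qed

lemma cauchy_solution_0: "cauchy_solution 0 (restrict (\<lambda>_. 1 / 2) {0..1})"
  unfolding cauchy_solution_def
proof (intro conjI ballI)
  show "continuous_on {0..1} (restrict (\<lambda>_. 1 / 2 :: real) {0..1::real})"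
    by (subst continuous_on_cong[OF refl, where g="\<lambda>_. 1/2"]) auto
  fix r :: real assume r: "r \<in> {0..<1}"
  show "(restrict (\<lambda>_. 1 / 2) {0..1} has_real_derivative
     0 * r / ((restrict (\<lambda>_. 1 / 2) {0..1}) r - r / 2)) (at r within {0..1})"
    by (rule has_field_derivative_transform_within[where f="\<lambda>_. 1/2" and d=1]) (use r in auto)
qed auto

text \<open>The solution is \<open>F\<close> composed with the inverse of \<open>R\<close>, where
  \<open>R\<close> and \<open>F\<close> solve the linear system in time. The product in the
  conclusion equals exp (- t/2) / 4 at the time t with R t = x; it is recorded because its sign is
  that of the second derivative of f.\<close>

lemma cauchy_solution_param:
  assumes c: "0 < c"
  obtains p T f where "0 < p" "c = p * (p + 1/2)" "0 < T"
    "exp (p * T) - exp (- (p + 1/2) * T) = 4 * p + 1"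
    "cauchy_solution c f"
    "f 1 + p = exp (p * T) / 2" "f 1 - (p + 1/2) = exp (- (p + 1/2) * T) / 2"
    "\<And>x. 0 \<le> x \<Longrightarrow> x \<le> 1 \<Longrightarrow> x / 2 < f x"
    "\<And>x. 0 \<le> x \<Longrightarrow> x \<le> 1 \<Longrightarrow> 0 < (f x + p * x) * (f x - (p + 1/2) * x)"
    "\<And>x. 0 \<le> x \<Longrightarrow> x \<le> 1 \<Longrightarrow>
       (f has_real_derivative (c * x / (f x - x / 2))) (at x within {0..1})"
proof -
  define p where "p = (sqrt (1/4 + 4 * c) - 1/2) / 2"
  define q where "q = p + 1/2"
  have "sqrt (1/4) < sqrt (1/4 + 4 * c)" using c by (subst real_sqrt_less_iff) simp
  then have p: "0 < p" by (simp add: p_def real_sqrt_divide)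
  have "(2 * p + 1/2)\<^sup>2 = 1/4 + 4 * c" using c by (simp add: p_def diff_divide_distrib)
  then have pq: "c = p * q" by (simp add: q_def algebra_simps power2_eq_square)
  have q: "0 < q" using p by (simp add: q_def)
  \<comment> \<open>The normalisation is 4 p + 1 = 2 (p + q); it gives R 0 = 0 and F 0 =
    1/2.\<close>
  define R where "R t = (exp (p * t) - exp (- q * t)) / (4 * p + 1)" for t
  define F where "F t = (q * exp (p * t) + p * exp (- q * t)) / (4 * p + 1)" for t
  define R' where "R' t = (p * exp (p * t) + q * exp (- q * t)) / (4 * p + 1)" for t
  have p4: "0 < 4 * p + 1" using p by simp
  have e: "((\<lambda>t. exp (p * t)) has_real_derivative p * exp (p * t)) (at t)"
    "((\<lambda>t. exp (- q * t)) has_real_derivative - q * exp (- q * t)) (at t)" for t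
    by (auto intro!: derivative_eq_intros)
  have dR: "(R has_real_derivative R' t) (at t)" for t
    using DERIV_cdivide[OF DERIV_diff[OF e(1)[of t] e(2)[of t]], of "4 * p + 1"] by (simp add: R_def[abs_def] R'_def)
  have dF: "(F has_real_derivative c * R t) (at t)" for t
  proof -
    have "(F has_real_derivative (q * (p * exp (p * t)) + p * (- q * exp (- q * t))) / (4 * p + 1)) (at t)"
      unfolding F_def[abs_def] by (intro DERIV_cdivide DERIV_add DERIV_cmult e)
    then show ?thesis by (simp add: R_def pq algebra_simps diff_divide_distrib)
  qed
  have R'pos: "0 < R' t" for t
    unfolding R'_def using p q p4 by (intro divide_pos_pos add_pos_pos mult_pos_pos) auto
  have FR: "F t - R t / 2 = R' t" for t
    unfolding F_def R_def R'_def q_def using p4 by (simp add: divide_simps) (simp add: algebra_simps)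
  have FRp: "F t + p * R t = exp (p * t) / 2" for t
    unfolding F_def R_def using p4 by (simp add: divide_simps) (simp add: q_def algebra_simps)
  have FRq: "F t - q * R t = exp (- q * t) / 2" for t
    unfolding F_def R_def using p4 by (simp add: divide_simps) (simp add: q_def algebra_simps)
  have mono: "R s < R t" if "s < t" for s t
    by (rule DERIV_pos_imp_increasing[OF that]) (use dR R'pos in blast)
  then have inj: "inj R" by (metis injI less_irrefl linorder_neqE_linordered_idom)
  have contR: "isCont R t" for t using dR DERIV_isCont by blast
  have contF: "isCont F t" for t using dF DERIV_isCont by blast
  \<comment> \<open>Chosen so that p * t1 = 4 * p + 1; the bound exp x \<ge> 1 + x then already
    yields R t1 \<ge> 1.\<close>
  define t1 where "t1 = (4 * p + 1) / p"
  have t1: "0 < t1" using p by (simp add: t1_def)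
  have "1 \<le> R t1"
  proof -
    have "1 + p * t1 \<le> exp (p * t1)" by (rule exp_ge_add_one_self)
    moreover have "exp (- q * t1) \<le> 1" using q t1 by simp
    moreover have "p * t1 = 4 * p + 1" using p by (simp add: t1_def)
    ultimately have "4 * p + 1 \<le> exp (p * t1) - exp (- q * t1)" by linarith
    then show ?thesis unfolding R_def using p4 by (simp only: le_divide_eq_1_pos)
  qed
  moreover have R0: "R 0 = 0" by (simp add: R_def)
  ultimately obtain T where T: "0 \<le> T" "R T = 1"
    using IVT[of R 0 1 t1] contR t1 by auto
  have T0: "0 < T" using T R0 by (cases "T = 0") auto
  define g where "g = inv R"
  have gR: "g (R t) = t" for t using inj by (simp add: g_def)
  \<comment> \<open>The inverse is controlled on an open interval containing [0,1], so that it is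
    differentiable from both sides at 0 and 1 as well.\<close>
  have Rg: "R (g y) = y" if "R (-1) < y" "y < R (T + 1)" for y
    using IVT[of R "-1" y "T+1"] that T contR gR by auto
  have lim: "R (-1) < 0" "1 < R (T + 1)" using mono[of "-1" 0] mono[of T "T+1"] T R0 by auto
  have contg: "isCont g y" if "R (-1) < y" "y < R (T + 1)" for y
    using isCont_inverse_function[of 1 "g y" g R] contR gR Rg[OF that] by auto
  define f where "f = restrict (\<lambda>x. F (g x)) {0..1}"
  have fx: "f x = F (g x)" "R (g x) = x" "R (-1) < x" "x < R (T + 1)" if "0 \<le> x" "x \<le> 1" for x
    using that lim Rg[of x] by (auto simp: f_def)
  have D: "(f has_real_derivative (c * x / (f x - x / 2))) (at x within {0..1})"
    if x: "0 \<le> x" "x \<le> 1" for x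
  proof -
    note fx = fx[OF x]
    have "(g has_real_derivative inverse (R' (g x))) (at x)"
      using R'pos[of "g x"]
      by (intro DERIV_inverse_function[where f=R and a="R (-1)" and b="R (T+1)"])
        (use dR fx contg Rg in auto)
    then have "((\<lambda>x. F (g x)) has_real_derivative c * R (g x) * inverse (R' (g x))) (at x)"
      by (intro DERIV_chain2[OF dF])
    moreover have "f x - x / 2 = R' (g x)" using FR[of "g x"] unfolding fx(1,2) .
    ultimately have "((\<lambda>x. F (g x)) has_real_derivative c * x / (f x - x / 2)) (at x)"
      unfolding fx(2) divide_inverse by simp
    then have "((\<lambda>x. F (g x)) has_real_derivative c * x / (f x - x / 2)) (at x within {0..1})"
      by (rule has_field_derivative_at_within)
    then show ?thesis
      by (rule has_field_derivative_transform_within[where d=1]) (use x in \<open>auto simp: f_def\<close>)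
  qed
  have half: "x / 2 < f x" if x: "0 \<le> x" "x \<le> 1" for x
    using FR[of "g x"] R'pos[of "g x"] unfolding fx(1,2)[OF x] by linarith
  have pos: "0 < (f x + p * x) * (f x - (p + 1/2) * x)" if x: "0 \<le> x" "x \<le> 1" for x
    unfolding fx(1)[OF x] q_def[symmetric]
    using FRp[of "g x"] FRq[of "g x"] unfolding fx(2)[OF x] by (simp only: mult_pos_pos half_gt_zero exp_gt_zero)
  have f1: "f 1 = F T" "R T = 1" using fx[of 1] gR[of T] T by auto
  have "f 0 = 1 / 2" using fx(1)[of 0] gR[of 0] R0 FRp[of 0] by simp
  moreover have "continuous_on {0..1} f"
    using D by (auto intro!: DERIV_continuous_on)
  ultimately have "cauchy_solution c f"
    using D half unfolding cauchy_solution_def by (force simp: f_def)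
  moreover have "exp (p * T) - exp (- (p + 1/2) * T) = 4 * p + 1"
    using T(2) p4 by (simp add: R_def q_def)
  ultimately show ?thesis
    using that[OF p _ T0 _ _ _ _ half pos D] pq FRp[of T] FRq[of T] f1 by (auto simp: q_def)
qed

lemma cauchy_solution_ex1: "0 \<le> c \<Longrightarrow> \<exists>!f. cauchy_solution c f"
proof (rule ex_ex1I)
  assume c: "0 \<le> c"
  show "\<exists>f. cauchy_solution c f"
  proof (cases "c = 0")
    case True then show ?thesis using cauchy_solution_0 by blast
  next
    case False
    with c have "0 < c" by simp
    from cauchy_solution_param[OF this] show ?thesis by blast
  qed
qed (rule cauchy_solution_unique)

lemma f_sol_eq: "0 \<le> c \<Longrightarrow> cauchy_solution c f \<Longrightarrow> f_sol c = f"
  unfolding f_sol_def using cauchy_solution_unique by blast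

lemma cauchy_solution_f_sol: "0 \<le> c \<Longrightarrow> cauchy_solution c (f_sol c)"
  unfolding f_sol_def using theI'[OF cauchy_solution_ex1] by blast

section \<open>The end condition\<close>

text \<open>The larger root E of E (E - (2 a + 1)) = a (a + 1). This is the equation for E = exp (p
  T) once exp (- T/2) is replaced by 4 c = a (a + 1), with a = 2 p. The discriminant simplifies
  through 4 a (a + 1) = (2 a + 1)^2 - 1.\<close>

definition endroot :: "real \<Rightarrow> real" where
  "endroot a = ((2 * a + 1) + sqrt (2 * (2 * a + 1)\<^sup>2 - 1)) / 2"

text \<open>Compares two values of p T. The end condition gives T = - 2 ln (a (a + 1)), hence p T =
  - a ln (a (a + 1)); the quadratic gives p T = ln (endroot a).\<close>

definition endgap :: "real \<Rightarrow> real" where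
  "endgap a = - (a * ln a + a * ln (a + 1)) - ln (endroot a)"

definition endgap' :: "real \<Rightarrow> real" where
  "endgap' a = - (ln a + ln (a + 1) + 1 + a / (a + 1))
     - 2 * (1 + 2 * (2 * a + 1) / sqrt (2 * (2 * a + 1)\<^sup>2 - 1))
         / ((2 * a + 1) + sqrt (2 * (2 * a + 1)\<^sup>2 - 1))"

context
  fixes a z g :: real
  assumes a: "0 < a"
  defines "z \<equiv> 2 * a + 1" and "g \<equiv> sqrt (2 * z\<^sup>2 - 1)"
begin

lemma endroot_arg_gt_1: "1 < z" using a by (simp add: z_def)

lemma endroot_arg_square_gt_1: "1 < z\<^sup>2" using endroot_arg_gt_1 by (intro one_less_power) auto

lemma endroot_sqrt_square: "g\<^sup>2 = 2 * z\<^sup>2 - 1"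
  unfolding g_def by (rule real_sqrt_pow2) (use endroot_arg_square_gt_1 in linarith)

lemma endroot_sqrt_ge_arg: "z \<le> g"
  unfolding g_def by (rule real_le_rsqrt) (use endroot_arg_square_gt_1 in linarith)

lemma endroot_eq: "endroot a = (z + g) / 2"
  by (simp add: endroot_def z_def g_def)

lemma endroot_gt_1: "1 < endroot a"
  using endroot_arg_gt_1 endroot_sqrt_ge_arg by (simp add: endroot_eq)

lemma endroot_quadratic: "endroot a * (endroot a - (2 * a + 1)) = a * (a + 1)"
proof -
  have "endroot a * (endroot a - z) = (g\<^sup>2 - z\<^sup>2) / 4"
    by (simp add: endroot_eq power2_eq_square field_simps)
  also have "\<dots> = a * (a + 1)"
    by (simp add: endroot_sqrt_square) (simp add: z_def power2_eq_square algebra_simps)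
  finally show ?thesis by (simp add: z_def)
qed

lemma DERIV_endroot_sqrt: "((\<lambda>a. sqrt (2 * (2 * a + 1)\<^sup>2 - 1)) has_real_derivative 4 * z / g) (at a)"
proof -
  have pos: "0 < 2 * (2 * a + 1)\<^sup>2 - 1" using endroot_arg_square_gt_1 unfolding z_def by linarith
  have D: "((\<lambda>a. 2 * (2 * a + 1)\<^sup>2 - 1) has_real_derivative 8 * z) (at a)"
    by (auto intro!: derivative_eq_intros simp: z_def)
  note DERIV_chain2[OF DERIV_real_sqrt[OF pos] D]
  moreover have "inverse g / 2 * (8 * z) = 4 * z / g" by (simp add: inverse_eq_divide)
  ultimately show ?thesis unfolding z_def[symmetric] g_def[symmetric] by simp
qed

lemma DERIV_endroot_arg: "((\<lambda>a. 2 * a + 1) has_real_derivative 2) (at a)"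
  by (auto intro!: derivative_eq_intros)

lemma DERIV_endgap: "(endgap has_real_derivative endgap' a) (at a)"
proof -
  have "(endroot has_real_derivative (2 + 4 * z / g) / 2) (at a)"
    using DERIV_cdivide[OF DERIV_add[OF DERIV_endroot_arg DERIV_endroot_sqrt], of 2] unfolding endroot_def[abs_def] .
  then have "((\<lambda>a. ln (endroot a)) has_real_derivative 1 / endroot a * ((2 + 4 * z / g) / 2)) (at a)"
    using endroot_gt_1 by (intro DERIV_chain2[OF DERIV_ln_divide]) auto
  moreover have "((\<lambda>a. - (a * ln a + a * ln (a + 1))) has_real_derivative
      - (ln a + ln (a + 1) + 1 + a / (a + 1))) (at a)"
    using a by (auto intro!: derivative_eq_intros simp: field_simps)
  ultimately have *: "(endgap has_real_derivative
      - (ln a + ln (a + 1) + 1 + a / (a + 1)) - 1 / endroot a * ((2 + 4 * z / g) / 2)) (at a)"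
    unfolding endgap_def[abs_def] by (intro DERIV_diff)
  have **: "1 / endroot a * ((2 + 4 * z / g) / 2) = 2 * (1 + 2 * z / g) / (z + g)"
  proof -
    have "(2 + 4 * z / g) / 2 = 1 + 2 * z / g" by (simp add: add_divide_distrib)
    then show ?thesis by (simp only: endroot_eq) simp
  qed
  show ?thesis
    using * unfolding ** endgap'_def z_def[symmetric] g_def[symmetric] .
qed

text \<open>The second derivative contains - 1/a, and its only positive terms come from - ln
  (endroot a). Because 1 < z \<le> g these are at most 4/g^2 and 9/g^2, and 13/g^2 < 1/a.\<close>

lemma DERIV_endgap': "\<exists>y. (endgap' has_real_derivative y) (at a) \<and> y < 0"
proof -
  have g0: "0 < g" "1 < g" using endroot_arg_gt_1 endroot_sqrt_ge_arg by auto
  define w where "w = (1 + 2 * z / g) / (z + g)"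
  have lin: "((\<lambda>a. 2 * (2 * a + 1)) has_real_derivative 4) (at a)"
    by (auto intro!: derivative_eq_intros)
  have ne: "sqrt (2 * (2 * a + 1)\<^sup>2 - 1) \<noteq> 0"
    "(2 * a + 1) + sqrt (2 * (2 * a + 1)\<^sup>2 - 1) \<noteq> 0"
    using g0 endroot_arg_gt_1 unfolding z_def[symmetric] g_def[symmetric] by auto
  have "((\<lambda>a. 2 * (2 * a + 1) / sqrt (2 * (2 * a + 1)\<^sup>2 - 1)) has_real_derivative
      (4 * g - 2 * z * (4 * z / g)) / (g * g)) (at a)"
    using DERIV_divide[OF lin DERIV_endroot_sqrt ne(1)] unfolding z_def[symmetric] g_def[symmetric] .
  moreover have "(4 * g - 2 * z * (4 * z / g)) / (g * g) = - 4 / g ^ 3"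
  proof -
    have "(4 * g - 2 * z * (4 * z / g)) / (g * g) = (4 * g\<^sup>2 - 8 * z\<^sup>2) / g ^ 3"
      using g0 by (simp add: field_simps power2_eq_square power3_eq_cube)
    then show ?thesis by (simp add: endroot_sqrt_square)
  qed
  ultimately have 1: "((\<lambda>a. 2 * (2 * a + 1) / sqrt (2 * (2 * a + 1)\<^sup>2 - 1)) has_real_derivative
      - 4 / g ^ 3) (at a)" by simp
  have "((\<lambda>a. 2 * (1 + 2 * (2 * a + 1) / sqrt (2 * (2 * a + 1)\<^sup>2 - 1))) has_real_derivative
      2 * (- 4 / g ^ 3)) (at a)"
    using DERIV_cmult[OF DERIV_add[OF DERIV_const 1], of 2 1] by simp
  from DERIV_divide[OF this DERIV_add[OF DERIV_endroot_arg DERIV_endroot_sqrt] ne(2)]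
  have D1: "((\<lambda>a. 2 * (1 + 2 * (2 * a + 1) / sqrt (2 * (2 * a + 1)\<^sup>2 - 1))
         / ((2 * a + 1) + sqrt (2 * (2 * a + 1)\<^sup>2 - 1))) has_real_derivative
      (2 * (- 4 / g ^ 3) * (z + g) - 2 * (1 + 2 * z / g) * (2 + 4 * z / g)) / ((z + g) * (z + g))) (at a)"
    unfolding z_def[symmetric] g_def[symmetric] .
  have e1: "(2 * (- 4 / g ^ 3) * (z + g) - 2 * (1 + 2 * z / g) * (2 + 4 * z / g)) / ((z + g) * (z + g))
      = - (8 / (g ^ 3 * (z + g)) + 4 * w\<^sup>2)" 
  proof -
    have "w * (z + g) = 1 + 2 * z / g" using g0 endroot_arg_gt_1 by (simp add: w_def)
    then have sq: "2 * (1 + 2 * z / g) * (2 + 4 * z / g) = 4 * (w * (z + g))\<^sup>2"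
      by (simp only: power2_eq_square) (simp add: algebra_simps)
    have gen: "(2 * (- 4 / G) * s - 4 * (w * s)\<^sup>2) / (s * s) = - (8 / (G * s) + 4 * w\<^sup>2)"
      if "s \<noteq> 0" "G \<noteq> 0" for s G :: real
      using that by (simp add: field_simps power2_eq_square)
    show ?thesis unfolding sq by (rule gen) (use g0 endroot_arg_gt_1 in auto)
  qed
  have D2: "((\<lambda>a. - (ln a + ln (a + 1) + 1 + a / (a + 1))) has_real_derivative
      - (1 / a + 1 / (a + 1) + 1 / ((a + 1) * (a + 1)))) (at a)"
  proof -
    have "((\<lambda>a. a / (a + 1)) has_real_derivative (1 * (a + 1) - a * 1) / ((a + 1) * (a + 1))) (at a)"
      by (rule DERIV_divide) (use a in \<open>auto intro!: derivative_eq_intros\<close>)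
    moreover have "((\<lambda>a. ln a + ln (a + 1) + 1) has_real_derivative 1 / a + 1 / (a + 1)) (at a)"
      using a by (auto intro!: derivative_eq_intros simp: field_simps)
    ultimately show ?thesis using DERIV_minus[OF DERIV_add] by fastforce
  qed
  have D: "(endgap' has_real_derivative
      - (1 / a + 1 / (a + 1) + 1 / ((a + 1) * (a + 1))) - (- (8 / (g ^ 3 * (z + g)) + 4 * w\<^sup>2))) (at a)"
    unfolding endgap'_def[abs_def] using DERIV_diff[OF D2 D1] unfolding e1 .
  have "8 / (g ^ 3 * (z + g)) \<le> 4 / g\<^sup>2"
  proof -
    have "g\<^sup>2 * 2 \<le> g\<^sup>2 * (g * (z + g))"
      using g0 endroot_arg_gt_1 mult_mono[of 1 g 2 "z + g"] by (intro mult_left_mono) auto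
    then have "8 / (g\<^sup>2 * (g * (z + g))) \<le> 8 / (g\<^sup>2 * 2)"
      using g0 by (intro divide_left_mono) (auto intro!: mult_pos_pos)
    then show ?thesis by (simp add: power2_eq_square power3_eq_cube mult.assoc)
  qed
  moreover have "4 * w\<^sup>2 \<le> 9 / g\<^sup>2"
  proof -
    have "w = (g + 2 * z) / (z + g) / g" using g0 endroot_arg_gt_1 by (simp add: w_def field_simps)
    also have "\<dots> \<le> 3 / 2 / g"
      by (rule divide_right_mono) (use g0 endroot_arg_gt_1 endroot_sqrt_ge_arg in \<open>simp_all add: divide_simps\<close>)
    finally have "w \<le> 3 / 2 / g" .
    moreover have "0 \<le> w" using g0 endroot_arg_gt_1 by (simp add: w_def)
    ultimately have "w\<^sup>2 \<le> (3 / 2 / g)\<^sup>2" by (intro power_mono)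
    then show ?thesis by (simp add: power_divide)
  qed
  moreover have "13 / g\<^sup>2 < 1 / a"
  proof -
    \<comment> \<open>The sum equals 8 (g^2 - 13 a), where g^2 = 8 a^2 + 8 a + 1.\<close>
    have "0 < (4 * z - 13 / 2)\<^sup>2 + 7 / 4" by (intro add_nonneg_pos) auto
    then have "13 * a < g\<^sup>2"
      unfolding endroot_sqrt_square by (simp add: z_def power2_eq_square algebra_simps)
    then show ?thesis using g0 a by (simp add: field_simps)
  qed
  moreover have "0 < 1 / (a + 1)" "0 < 1 / ((a + 1) * (a + 1))" using a by auto
  ultimately have "- (1 / a + 1 / (a + 1) + 1 / ((a + 1) * (a + 1))) - (- (8 / (g ^ 3 * (z + g)) + 4 * w\<^sup>2)) < 0"
    by linarith
  with D show ?thesis by blast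
qed

text \<open>Near 0 the term - a ln (a (a + 1)) beats the linear bound ln (endroot a) \<le> 3 a. The
  threshold 1/50 is small enough for a (a + 1) < 1/27 \<le> exp (- 3).\<close>

lemma endgap_pos_near_0:
  assumes "a \<le> 1 / 50"
  shows "0 < endgap a"
proof -
  have "g \<le> 1 + 4 * a"
    unfolding g_def z_def using a by (intro real_le_lsqrt) (auto simp: power2_eq_square algebra_simps)
  then have "endroot a \<le> 1 + 3 * a" by (simp add: endroot_eq z_def)
  then have 1: "ln (endroot a) \<le> 3 * a"
    using ln_le_minus_one[of "endroot a"] endroot_gt_1 by simp
  have "a * (a + 1) \<le> 1/50 * (1/50 + 1)" using a assms by (intro mult_mono) auto
  also have "\<dots> < 1 / 27" by simp
  also have "1 / 27 \<le> exp (- 3 :: real)"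
  proof -
    have "exp 1 ^ 3 \<le> (3 :: real) ^ 3" by (intro power_mono exp_le) auto
    moreover have "exp 1 ^ 3 = exp (3 :: real)" by (simp add: exp_of_nat_mult[symmetric])
    ultimately show ?thesis by (simp add: exp_minus field_simps)
  qed
  finally have "ln (a * (a + 1)) < - 3"
    using a by (metis ln_less_cancel_iff ln_exp exp_gt_zero mult_pos_pos add_pos_pos zero_less_one)
  then have "a * ln (a * (a + 1)) < a * (- 3)" using a by (intro mult_strict_left_mono)
  moreover have "ln (a * (a + 1)) = ln a + ln (a + 1)" using a by (simp add: ln_mult)
  ultimately show ?thesis using 1 unfolding endgap_def by (simp only: distrib_left)
qed

end

text \<open>Two roots x < y would give a zero of the derivative at some t between them, while
  positivity near 0 gives a negative slope at some u < x. This contradicts the strict decrease of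
  \<open>endgap'\<close>.\<close>

lemma endgap_unique_root: "\<exists>!a. 0 < a \<and> endgap a = 0"
proof (rule ex_ex1I)
  have "continuous_on {1/50..1} endgap"
    by (auto intro!: continuous_at_imp_continuous_on DERIV_isCont[OF DERIV_endgap])
  moreover have "endgap 1 \<le> 0"
  proof -
    have "endgap 1 = - ln 2 - ln (endroot 1)" by (simp add: endgap_def)
    moreover have "0 < ln (2 :: real)" "0 < ln (endroot 1)" using endroot_gt_1[of 1] by simp_all
    ultimately show ?thesis by linarith
  qed
  moreover have "0 \<le> endgap (1/50)" using endgap_pos_near_0[of "1/50"] by simp
  ultimately obtain x where "1/50 \<le> x" "endgap x = 0"
    using IVT2'[of endgap 1 0 "1/50"] by auto
  then show "\<exists>a. 0 < a \<and> endgap a = 0" by (intro exI[of _ x]) auto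
next
  have less: False if xy: "0 < x" "x < y" "endgap x = 0" "endgap y = 0" for x y
  proof -
    obtain t where t: "x < t" "t < y" "endgap y - endgap x = (y - x) * endgap' t"
      using MVT2[OF xy(2), of endgap endgap'] DERIV_endgap xy(1) by (metis order_less_le_trans)
    then have t0: "endgap' t = 0" using xy by simp
    define s where "s = min (1 / 50) (x / 2)"
    have s: "0 < s" "s < x" "s \<le> 1/50" using xy by (auto simp: s_def)
    obtain u where u: "s < u" "u < x" "endgap x - endgap s = (x - s) * endgap' u"
      using MVT2[OF s(2), of endgap endgap'] DERIV_endgap s(1) by (metis order_less_le_trans)
    have "endgap' t < endgap' u"
      by (rule DERIV_neg_imp_decreasing) (use u t s in \<open>auto intro!: DERIV_endgap'\<close>)
    then have "0 < (x - s) * endgap' u" using t0 s by simp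
    then show False using u xy endgap_pos_near_0[OF s(1,3)] by simp
  qed
  fix x y assume "0 < x \<and> endgap x = 0" "0 < y \<and> endgap y = 0"
  then show "x = y" using less by (metis linorder_neqE_linordered_idom)
qed

text \<open>Here y is f 1. Both y^2 - y/2 - c and exp (- T/2) / 4 equal the product (y + p) (y - (p
  + 1/2)), so the end condition says exp (- T/2) = 4 c. As T > 0, this forces 4 c < 1.\<close>

lemma end_condition_iff:
  assumes p: "0 < p" and c: "c = p * (p + 1/2)" and T: "exp (p * T) - exp (- (p + 1/2) * T) = 4 * p + 1"
    and T0: "0 < T"
    and y: "y + p = exp (p * T) / 2" "y - (p + 1/2) = exp (- (p + 1/2) * T) / 2"
  shows "y\<^sup>2 - y / 2 = 2 * c \<longleftrightarrow> endgap (2 * p) = 0" "y\<^sup>2 - y / 2 = 2 * c \<Longrightarrow> c < 1/4"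
proof -
  define a where "a = 2 * p"
  have a: "0 < a" using p by (simp add: a_def)
  define E where "E = exp (p * T)"
  define L where "L = exp (- T / 2)"
  have E1: "1 < E" using p T0 by (simp add: E_def)
  have EL: "exp (- (p + 1/2) * T) = L / E"
    by (simp add: E_def L_def exp_diff[symmetric] algebra_simps)
  have Eeq: "E * (E - (2 * a + 1)) = L"
    using T E1 unfolding EL E_def[symmetric] by (simp add: a_def field_simps)
  have yL: "(y + p) * (y - (p + 1/2)) = L / 4"
    unfolding y EL E_def[symmetric] using E1 by simp
  have "y\<^sup>2 - y / 2 - c = (y + p) * (y - (p + 1/2))"
    by (simp add: c algebra_simps power2_eq_square)
  then have iff: "y\<^sup>2 - y / 2 = 2 * c \<longleftrightarrow> L = a * (a + 1)"
    unfolding yL by (auto simp: c a_def algebra_simps)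
  have "L < 1" using T0 by (simp add: L_def)
  then show "y\<^sup>2 - y / 2 = 2 * c \<Longrightarrow> c < 1/4"
    unfolding iff by (simp add: c a_def algebra_simps)
  have gap: "endgap a = - a * ln (a * (a + 1)) - ln (endroot a)"
    using a ln_mult_pos[of a "a + 1"] by (simp only: endgap_def) (simp add: distrib_left)
  have "L = a * (a + 1) \<longleftrightarrow> endgap a = 0"
  proof
    assume L: "L = a * (a + 1)"
    \<comment> \<open>\<open>E\<close> and \<open>endroot a\<close> solve the same quadratic. The
      second factor is the difference to the other root, which is negative, so the first factor
      vanishes.\<close>
    have "(E - endroot a) * (E + endroot a - (2 * a + 1)) = 0"
      using Eeq endroot_quadratic[OF a] unfolding L by (simp add: algebra_simps)
    moreover have "0 < endroot a - (2 * a + 1)"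
      using endroot_quadratic[OF a] endroot_gt_1[OF a] a by (metis add_pos_pos mult_pos_pos zero_less_mult_pos zero_less_one less_trans)
    ultimately have "endroot a = E" using E1 by auto
    then have "ln (endroot a) = p * T" by (simp add: E_def)
    moreover have "ln (a * (a + 1)) = - T / 2" unfolding L[symmetric] by (simp add: L_def)
    ultimately show "endgap a = 0" unfolding gap by (simp add: a_def)
  next
    assume 0: "endgap a = 0"
    \<comment> \<open>The time prescribed by the end condition. It satisfies the equation that
      characterises T, whose left-hand side is strictly increasing in time.\<close>
    define S where "S = - 2 * ln (a * (a + 1))"
    have "ln (endroot a) = p * S" using 0 unfolding gap S_def by (simp add: a_def)
    then have ES: "exp (p * S) = endroot a" using endroot_gt_1[OF a] by (metis exp_ln less_trans zero_less_one)
    have LS: "exp (- S / 2) = a * (a + 1)" using a by (simp add: S_def)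
    have "exp (- (p + 1/2) * S) = exp (- S / 2) / exp (p * S)"
      by (simp add: exp_diff[symmetric] algebra_simps)
    also have "\<dots> = endroot a - (2 * a + 1)"
      unfolding ES LS using endroot_quadratic[OF a] endroot_gt_1[OF a] by (simp add: field_simps)
    finally have S: "exp (p * S) - exp (- (p + 1/2) * S) = 4 * p + 1"
      by (simp add: ES a_def)
    have mono: "exp (p * s) - exp (- (p + 1/2) * s) < exp (p * t) - exp (- (p + 1/2) * t)"
      if "s < t" for s t
    proof -
      have "exp (p * s) < exp (p * t)" "exp (- (p + 1/2) * t) < exp (- (p + 1/2) * s)"
        using p that by (simp_all del: minus_add_distrib)
      then show ?thesis by linarith
    qed
    have "S = T" using mono[of S T] mono[of T S] S T by (cases S T rule: linorder_cases) auto
    then show "L = a * (a + 1)" using LS by (simp add: L_def)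
  qed
  then show "y\<^sup>2 - y / 2 = 2 * c \<longleftrightarrow> endgap (2 * p) = 0"
    unfolding iff by (simp add: a_def)
qed

lemma f_sol_0: "0 \<le> x \<Longrightarrow> x \<le> 1 \<Longrightarrow> f_sol 0 x = 1 / 2"
  using f_sol_eq[OF _ cauchy_solution_0] by simp

text \<open>On p > 0 the map p (p + 1/2) is injective, so the one root of \<open>endgap\<close>
  yields one positive c. The value c = 0 lies outside this parametrisation and is supplied by the
  constant solution 1/2.\<close>

lemma end_condition_solutions:
  "\<exists>c2. 0 < c2 \<and> c2 < 1/4 \<and> {c. 0 \<le> c \<and> (f_sol c 1)\<^sup>2 - f_sol c 1 / 2 = 2 * c} = {0, c2}"
proof -
  obtain a where a: "0 < a" "endgap a = 0" and uniq: "\<And>b. 0 < b \<Longrightarrow> endgap b = 0 \<Longrightarrow> b = a"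
    using endgap_unique_root by auto
  define c2 where "c2 = a / 2 * (a / 2 + 1 / 2)"
  have c2: "0 < c2" using a by (simp add: c2_def)
  have *: "((f_sol c 1)\<^sup>2 - f_sol c 1 / 2 = 2 * c) \<longleftrightarrow> c = c2"
    "(f_sol c 1)\<^sup>2 - f_sol c 1 / 2 = 2 * c \<Longrightarrow> c < 1/4" if c: "0 < c" for c
  proof -
    obtain p T f where P: "0 < p" "c = p * (p + 1/2)" "0 < T"
      "exp (p * T) - exp (- (p + 1/2) * T) = 4 * p + 1" "cauchy_solution c f"
      "f 1 + p = exp (p * T) / 2" "f 1 - (p + 1/2) = exp (- (p + 1/2) * T) / 2"
      by (rule cauchy_solution_param[OF c]) (rule that; assumption)
    have f: "f_sol c = f" using f_sol_eq[of c f] c P(5) by simp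
    note E = end_condition_iff[OF P(1,2,4,3,6,7)]
    have "endgap (2 * p) = 0 \<longleftrightarrow> 2 * p = a" using uniq[of "2*p"] P(1) a by auto
    also have "\<dots> \<longleftrightarrow> c = c2"
    proof
      assume "c = c2"
      then have "(2 * p - a) * (2 * p + a + 1) = 0" using P(2) by (simp add: c2_def algebra_simps)
      then show "2 * p = a" using P(1) a by auto
    qed (use P(2) in \<open>auto simp: c2_def\<close>)
    finally show "((f_sol c 1)\<^sup>2 - f_sol c 1 / 2 = 2 * c) \<longleftrightarrow> c = c2"
      unfolding f using E(1) by simp
    show "(f_sol c 1)\<^sup>2 - f_sol c 1 / 2 = 2 * c \<Longrightarrow> c < 1/4" unfolding f using E(2) .
  qed
  have "(f_sol c 1)\<^sup>2 - f_sol c 1 / 2 = 2 * c \<longleftrightarrow> c \<in> {0, c2}" if "0 \<le> c" for c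
    using *(1)[of c] that c2 f_sol_0[of 1] by (cases "c = 0") (auto simp: power2_eq_square)
  then have "{c. 0 \<le> c \<and> (f_sol c 1)\<^sup>2 - f_sol c 1 / 2 = 2 * c} = {0, c2}" using c2 by auto
  moreover have "c2 < 1/4" using *[OF c2] by simp
  ultimately show ?thesis using c2 by blast
qed

section \<open>Measures on the square and their corner probabilities\<close>

definition corner :: "real \<Rightarrow> real \<Rightarrow> (ereal \<times> ereal) set" where
  "corner r s = ({0..ereal r} \<times> I_set) \<union> (I_set \<times> {0..ereal s})"

text \<open>The symmetric extension of a profile that is homogeneous of degree 1. At the origin the
  factor \<open>max r s\<close> makes it 0, whatever f is at 0 / 0.\<close>

definition homog :: "(real \<Rightarrow> real) \<Rightarrow> real \<Rightarrow> real \<Rightarrow> real" where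
  "homog f r s = max r s * f (min r s / max r s)"

lemma homog_commute: "homog f r s = homog f s r"
  by (simp add: homog_def max.commute min.commute)

lemma homog_le: "s \<le> r \<Longrightarrow> homog f r s = r * f (s / r)"
  by (simp add: homog_def max_absorb1 min_absorb2)

lemma homog_scale:
  assumes "0 \<le> t"
  shows "homog f (t * r) (t * s) = t * homog f r s"
proof (cases "t = 0")
  case False
  have "max (t * r) (t * s) = t * max r s" "min (t * r) (t * s) = t * min r s"
    using assms by (simp_all add: max_mult_distrib_left min_mult_distrib_left)
  then show ?thesis using False by (simp add: homog_def)
qed (simp add: homog_def)

lemma Icc_subset_I_set: "r \<le> 1 \<Longrightarrow> {0..ereal r} \<subseteq> I_set"
  using sets.sets_into_space[OF Icc_I_meas] by (simp add: space_I_meas)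

lemma space_I2_meas: "space I2_meas = I_set \<times> I_set"
  by (simp add: I2_meas_def space_pair_measure space_I_meas)

lemma I_set_I_meas [simp]: "I_set \<in> sets I_meas"
  using sets.top[of I_meas] by (simp add: space_I_meas)

lemma rectangle_sets: "A \<in> sets I_meas \<Longrightarrow> B \<in> sets I_meas \<Longrightarrow> A \<times> B \<in> sets I2_meas"
  by (simp add: I2_meas_def)

lemma corner_sets: "r \<le> 1 \<Longrightarrow> s \<le> 1 \<Longrightarrow> corner r s \<in> sets I2_meas"
  unfolding corner_def by (intro sets.Un rectangle_sets Icc_I_meas) auto

lemma corner_mono: "r \<le> r' \<Longrightarrow> s \<le> s' \<Longrightarrow> corner r s \<subseteq> corner r' s'"
  unfolding corner_def by (intro Un_mono Sigma_mono) auto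

lemma swap_measurable: "(\<lambda>(x, y). (y, x)) \<in> I2_meas \<rightarrow>\<^sub>M I2_meas"
  unfolding I2_meas_def by (rule measurable_pair_swap')

lemma fst_measurable: "fst \<in> I2_meas \<rightarrow>\<^sub>M I_meas"
  and snd_measurable: "snd \<in> I2_meas \<rightarrow>\<^sub>M I_meas"
  unfolding I2_meas_def by auto

lemma prob_algebraD:
  assumes "\<mu> \<in> space (prob_algebra I2_meas)"
  shows "prob_space \<mu>" "sets \<mu> = sets I2_meas" "space \<mu> = I_set \<times> I_set"
  using assms sets_eq_imp_space_eq[of \<mu> I2_meas] by (auto simp: space_prob_algebra space_I2_meas)

lemma distr_prob_algebra:
  assumes "\<mu> \<in> space (prob_algebra I2_meas)" "h \<in> I2_meas \<rightarrow>\<^sub>M I2_meas"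
  shows "distr \<mu> I2_meas h \<in> space (prob_algebra I2_meas)"
proof -
  have "h \<in> \<mu> \<rightarrow>\<^sub>M I2_meas"
    using assms(2) measurable_cong_sets[OF prob_algebraD(2)[OF assms(1)] refl] by blast
  then show ?thesis
    using prob_space.prob_space_distr[OF prob_algebraD(1)[OF assms(1)]]
    by (simp add: space_prob_algebra)
qed

section \<open>Corner sets determine a measure\<close>

definition above :: "ereal \<Rightarrow> ereal set" where
  "above a = {x \<in> I_set. a < x}"

lemma sets_I_meas_above: "sets I_meas = sigma_sets I_set (range above)"
proof -
  have "sets (borel :: ereal measure) = sigma_sets UNIV (range greaterThan)"
    by (subst borel_Ioi) simp
  then have "sets I_meas = (\<inter>) I_set ` sigma_sets UNIV (range greaterThan)"
    by (simp add: I_meas_def sets_restrict_space)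
  also have "\<dots> = sigma_sets I_set ((\<inter>) I_set ` range greaterThan)"
    using I_set_borel \<open>sets borel = _\<close> by (intro sigma_sets_Int) auto
  also have "(\<inter>) I_set ` range greaterThan = range above"
    by (auto simp: above_def image_iff greaterThan_def)
  finally show ?thesis .
qed

lemma above_sets: "above a \<in> sets I_meas"
  unfolding sets_I_meas_above by auto

lemma sets_I2_meas_above:
  "sets I2_meas = sigma_sets (I_set \<times> I_set) {above a \<times> above b | a b. True}"
proof -
  \<comment> \<open>The ray from - \<infinity> is the whole space and serves as the countable cover
    that the product generator requires.\<close>
  have neg: "above (- \<infinity>) = I_set" "- \<infinity> \<notin> I_set" by (auto simp: above_def I_set_def)
  have "sets I2_meas = sets (sigma (I_set \<times> I_set) {A \<times> B | A B. A \<in> range above \<and> B \<in> range above})"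
    unfolding I2_meas_def space_I_meas[symmetric]
    by (rule sets_pair_eq[where Ca="{above (- \<infinity>)}" and Cb="{above (- \<infinity>)}"])
      (auto simp: space_I_meas sets_I_meas_above neg above_def)
  also have "{A \<times> B | A B. A \<in> range above \<and> B \<in> range above} = {above a \<times> above b | a b. True}"
    by auto
  finally show ?thesis
    by (simp add: sets_measure_of_conv) (auto simp: above_def)
qed

lemma compl_corner:
  assumes "0 \<le> r" "r \<le> 1" "0 \<le> s" "s \<le> 1"
  shows "above (ereal r) \<times> above (ereal s) = I_set \<times> I_set - corner r s"
  using assms unfolding above_def corner_def by (auto simp: I_set_def not_le)

text \<open>Corners have indices in [0,1] only. A ray starting beyond 1 is {\<infinity>}, just as
  the ray from 1; a ray starting below 0 exceeds the ray from 0 by the single point 0.\<close>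

lemma above_clamp:
  assumes "a < \<infinity>"
  obtains r where "0 \<le> r" "r \<le> 1" "above (ereal r) \<subseteq> above a" "above a \<subseteq> above (ereal r) \<union> {0}"
proof (cases "a < 0")
  case True
  then show ?thesis
    by (intro that[of 0]) (auto simp: above_def I_set_def zero_ereal_def[symmetric] intro: less_trans)
next
  case False
  then obtain t where t: "a = ereal t" "0 \<le> t" using assms by (cases a) auto
  show ?thesis
  proof (cases "t \<le> 1")
    case True
    then show ?thesis using t by (intro that[of t]) auto
  next
    case False
    then have "ereal 1 < a" using t by simp
    then have "above (ereal 1) \<subseteq> above a" "above a \<subseteq> above (ereal 1)"
      using assms by (auto simp: above_def I_set_def one_ereal_def)
    then show ?thesis by (intro that[of 1]) auto
  qed
qed

text \<open>Products of rays are stable under intersection and generate the sigma-algebra. Up to the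
  axes \<open>corner 0 0\<close>, each nonempty one is the complement of a corner, which is why the
  axes have to be null.\<close>

lemma corner_measure_eqI:
  assumes \<mu>: "\<mu> \<in> space (prob_algebra I2_meas)" and \<nu>: "\<nu> \<in> space (prob_algebra I2_meas)"
    and eq: "\<And>r s. 0 \<le> r \<Longrightarrow> r \<le> 1 \<Longrightarrow> 0 \<le> s \<Longrightarrow> s \<le> 1 \<Longrightarrow> measure \<mu> (corner r s) = measure \<nu> (corner r s)"
    and null: "measure \<mu> (corner 0 0) = 0"
  shows "\<mu> = \<nu>"
proof -
  have *: "measure \<mu> (above a \<times> above b) = 1 - measure \<mu> (corner r s)"
    if \<mu>: "\<mu> \<in> space (prob_algebra I2_meas)" and null: "measure \<mu> (corner 0 0) = 0"
      and r: "0 \<le> r" "r \<le> 1" "above (ereal r) \<subseteq> above a" "above a \<subseteq> above (ereal r) \<union> {0}"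
      and s: "0 \<le> s" "s \<le> 1" "above (ereal s) \<subseteq> above b" "above b \<subseteq> above (ereal s) \<union> {0}"
    for \<mu> a b r s
  proof -
    interpret prob_space \<mu> by (rule prob_algebraD[OF \<mu>])
    note S = prob_algebraD(2)[OF \<mu>]
    have N: "corner 0 0 \<in> null_sets \<mu>"
      using null corner_sets[of 0 0] by (simp add: null_sets_def S emeasure_eq_measure)
    have R: "above c \<times> above d \<in> sets \<mu>" for c d
      unfolding S by (intro rectangle_sets above_sets)
    have "measure \<mu> (above a \<times> above b) = measure \<mu> (above a \<times> above b \<union> corner 0 0)"
      using measure_Un_null_set[OF R N] by simp
    also have "above a \<times> above b \<union> corner 0 0 = above (ereal r) \<times> above (ereal s) \<union> corner 0 0"
      using r s by (auto simp: corner_def above_def zero_ereal_def)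
    also have "measure \<mu> \<dots> = measure \<mu> (above (ereal r) \<times> above (ereal s))"
      using measure_Un_null_set[OF R N] by simp
    also have "\<dots> = 1 - measure \<mu> (corner r s)"
      unfolding compl_corner[OF r(1,2) s(1,2)]
      using prob_compl[of "corner r s"] corner_sets[of r s] r s
      by (simp add: S prob_algebraD(3)[OF \<mu>])
    finally show ?thesis .
  qed
  interpret m: prob_space \<mu> by (rule prob_algebraD[OF \<mu>])
  interpret n: prob_space \<nu> by (rule prob_algebraD[OF \<nu>])
  have null': "measure \<nu> (corner 0 0) = 0" using eq[of 0 0] null by simp
  have E: "measure \<mu> (above a \<times> above b) = measure \<nu> (above a \<times> above b)" for a b
  proof (cases "a < \<infinity> \<and> b < \<infinity>")
    case True
    then obtain r s where r: "0 \<le> r" "r \<le> 1" "above (ereal r) \<subseteq> above a" "above a \<subseteq> above (ereal r) \<union> {0}"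
      and s: "0 \<le> s" "s \<le> 1" "above (ereal s) \<subseteq> above b" "above b \<subseteq> above (ereal s) \<union> {0}"
      using above_clamp[of a] above_clamp[of b] by metis
    show ?thesis using *[OF \<mu> null r s] *[OF \<nu> null' r s] eq r s by simp
  next
    case False
    then have "above a = {} \<or> above b = {}" by (auto simp: above_def)
    then show ?thesis by auto
  qed
  show ?thesis
  proof (rule measure_eqI_generator_eq[where A="\<lambda>_. above (- \<infinity>) \<times> above (- \<infinity>)"
        and \<Omega>="I_set \<times> I_set" and E="{above a \<times> above b | a b. True}"])
    show "Int_stable {above a \<times> above b | a b. True}"
      unfolding Int_stable_def
    proof (intro ballI)
      fix A B assume "A \<in> {above a \<times> above b | a b. True}" "B \<in> {above a \<times> above b | a b. True}"
      then obtain a b a' b' where AB: "A = above a \<times> above b" "B = above a' \<times> above b'" by blast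
      have "A \<inter> B = above (max a a') \<times> above (max b b')"
        unfolding AB by (auto simp: above_def)
      then show "A \<inter> B \<in> {above a \<times> above b | a b. True}" by blast
    qed
    show "sets \<mu> = sigma_sets (I_set \<times> I_set) {above a \<times> above b | a b. True}"
      "sets \<nu> = sigma_sets (I_set \<times> I_set) {above a \<times> above b | a b. True}"
      using prob_algebraD(2)[OF \<mu>] prob_algebraD(2)[OF \<nu>] sets_I2_meas_above by simp_all
    show "emeasure \<mu> X = emeasure \<nu> X" if "X \<in> {above a \<times> above b | a b. True}" for X
      using that E by (auto simp: m.emeasure_eq_measure n.emeasure_eq_measure)
    show "range (\<lambda>_. above (- \<infinity>) \<times> above (- \<infinity>)) \<subseteq> {above a \<times> above b | a b. True}"
      by blast
  qed (auto simp: above_def I_set_def)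
qed

lemma corner_measure_eqI_homog:
  assumes "\<mu> \<in> space (prob_algebra I2_meas)" "\<nu> \<in> space (prob_algebra I2_meas)"
    and "\<And>r s. 0 \<le> r \<Longrightarrow> r \<le> 1 \<Longrightarrow> 0 \<le> s \<Longrightarrow> s \<le> 1 \<Longrightarrow> measure \<mu> (corner r s) = homog f r s"
    and "\<And>r s. 0 \<le> r \<Longrightarrow> r \<le> 1 \<Longrightarrow> 0 \<le> s \<Longrightarrow> s \<le> 1 \<Longrightarrow> measure \<nu> (corner r s) = homog f r s"
  shows "\<mu> = \<nu>"
  by (rule corner_measure_eqI) (use assms in \<open>auto simp: homog_def\<close>)

text \<open>A profile says nothing at the origin. There the value 0 is forced, since
  \<open>corner 0 0\<close> lies in \<open>corner t t\<close>, whose mass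
  \<open>t * f_sol c 1\<close> tends to 0 with t.\<close>

lemma has_profile_iff:
  assumes \<mu>: "\<mu> \<in> space (prob_algebra I2_meas)"
  shows "has_profile \<mu> c \<longleftrightarrow> (\<forall>r\<in>{0..1}. \<forall>s\<in>{0..1}. measure \<mu> (corner r s) = homog (f_sol c) r s)"
proof
  assume P: "has_profile \<mu> c"
  have 1: "measure \<mu> (corner r s) = homog (f_sol c) r s" if "r \<in> {0..1}" "s \<in> {0..1}" "(r, s) \<noteq> (0, 0)" for r s
    using P that unfolding has_profile_def corner_def homog_def
    by (metis max.commute min.commute)
  interpret prob_space \<mu> by (rule prob_algebraD[OF \<mu>])
  have "measure \<mu> (corner 0 0) \<le> t * f_sol c 1" if "0 < t" "t \<le> 1" for t
  proof -
    have "measure \<mu> (corner 0 0) \<le> measure \<mu> (corner t t)"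
      using that corner_sets[of t t] by (intro finite_measure_mono corner_mono) (auto simp: prob_algebraD(2)[OF \<mu>])
    then show ?thesis using that 1[of t t] by (simp add: homog_def)
  qed
  then have "\<forall>\<^sub>F t in at_right 0. measure \<mu> (corner 0 0) \<le> t * f_sol c 1"
    using eventually_at_right_real[of 0 1] by (auto elim: eventually_mono)
  moreover have "((\<lambda>t. t * f_sol c 1) \<longlongrightarrow> 0 * f_sol c 1) (at_right 0)"
    by (intro tendsto_intros)
  ultimately have "measure \<mu> (corner 0 0) \<le> 0"
    using tendsto_lowerbound[of "\<lambda>t. t * f_sol c 1" 0 "at_right 0"] by simp
  then have "measure \<mu> (corner 0 0) = homog (f_sol c) 0 0"
    using measure_nonneg[of \<mu> "corner 0 0"] by (simp add: homog_def)
  then show "\<forall>r\<in>{0..1}. \<forall>s\<in>{0..1}. measure \<mu> (corner r s) = homog (f_sol c) r s"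
    using 1 by (metis prod.inject)
next
  assume "\<forall>r\<in>{0..1}. \<forall>s\<in>{0..1}. measure \<mu> (corner r s) = homog (f_sol c) r s"
  then show "has_profile \<mu> c"
    unfolding has_profile_def corner_def homog_def by (metis max.commute min.commute)
qed

section \<open>Symmetry, marginals and membership in the class\<close>

context
  fixes \<mu> :: "(ereal \<times> ereal) measure"
  assumes \<mu>: "\<mu> \<in> space (prob_algebra I2_meas)"
begin

interpretation prob_space \<mu> by (rule prob_algebraD[OF \<mu>])

lemma measure_swap:
  assumes "A \<in> sets I_meas" "B \<in> sets I_meas" "C \<in> sets I_meas" "D \<in> sets I_meas"
  shows "measure (distr \<mu> I2_meas (\<lambda>(x, y). (y, x))) (A \<times> B \<union> C \<times> D) = measure \<mu> (B \<times> A \<union> D \<times> C)"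
proof -
  have m: "(\<lambda>(x, y). (y, x)) \<in> \<mu> \<rightarrow>\<^sub>M I2_meas"
    using swap_measurable measurable_cong_sets[OF prob_algebraD(2)[OF \<mu>] refl] by blast
  have "A \<subseteq> I_set" "B \<subseteq> I_set" "C \<subseteq> I_set" "D \<subseteq> I_set"
    using assms sets.sets_into_space by (fastforce simp: space_I_meas)+
  then have "(\<lambda>(x, y). (y, x)) -` (A \<times> B \<union> C \<times> D) \<inter> space \<mu> = B \<times> A \<union> D \<times> C"
    by (auto simp: prob_algebraD(3)[OF \<mu>])
  then show ?thesis
    using assms by (subst measure_distr[OF m]) (auto intro!: rectangle_sets)
qed

lemma measure_swap_corner:
  assumes "r \<le> 1" "s \<le> 1"
  shows "measure (distr \<mu> I2_meas (\<lambda>(x, y). (y, x))) (corner r s) = measure \<mu> (corner s r)"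
  unfolding corner_def using assms by (subst measure_swap) (auto simp: Icc_I_meas Un_commute)

lemma measure_marginals:
  assumes "A \<in> sets I_meas"
  shows "measure (distr \<mu> I_meas fst) A = measure \<mu> (A \<times> I_set)"
    and "measure (distr \<mu> I_meas snd) A = measure \<mu> (I_set \<times> A)"
proof -
  have "fst \<in> \<mu> \<rightarrow>\<^sub>M I_meas" "snd \<in> \<mu> \<rightarrow>\<^sub>M I_meas"
    using fst_measurable snd_measurable measurable_cong_sets[OF prob_algebraD(2)[OF \<mu>] refl] by blast+
  moreover have "A \<subseteq> I_set" using assms sets.sets_into_space by (fastforce simp: space_I_meas)
  then have "fst -` A \<inter> space \<mu> = A \<times> I_set" "snd -` A \<inter> space \<mu> = I_set \<times> A"
    by (auto simp: prob_algebraD(3)[OF \<mu>])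
  ultimately show "measure (distr \<mu> I_meas fst) A = measure \<mu> (A \<times> I_set)"
    "measure (distr \<mu> I_meas snd) A = measure \<mu> (I_set \<times> A)"
    using assms by (auto simp: measure_distr)
qed

lemma measure_Icc_Icc:
  assumes "distr \<mu> I_meas fst = rho" "distr \<mu> I_meas snd = rho"
    and "0 \<le> r" "r \<le> 1" "0 \<le> s" "s \<le> 1"
  shows "measure \<mu> ({0..ereal r} \<times> {0..ereal s}) = r / 2 + s / 2 - measure \<mu> (corner r s)"
proof -
  have S: "{0..ereal r} \<times> I_set \<in> sets \<mu>" "I_set \<times> {0..ereal s} \<in> sets \<mu>"
    unfolding prob_algebraD(2)[OF \<mu>] using assms by (auto intro!: rectangle_sets Icc_I_meas)
  have "measure \<mu> ({0..ereal r} \<times> I_set) = r / 2" "measure \<mu> (I_set \<times> {0..ereal s}) = s / 2"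
    using measure_marginals Icc_I_meas rho_Icc assms by metis+
  moreover have "({0..ereal r} \<times> I_set) \<inter> (I_set \<times> {0..ereal s}) = {0..ereal r} \<times> {0..ereal s}"
    using Icc_subset_I_set assms by blast
  moreover have "measure \<mu> (corner r s) = measure \<mu> ({0..ereal r} \<times> I_set) + measure \<mu> (I_set \<times> {0..ereal s})
      - measure \<mu> (({0..ereal r} \<times> I_set) \<inter> (I_set \<times> {0..ereal s}))"
    unfolding corner_def by (rule measure_Un3) (use S in \<open>auto simp: fmeasurable_eq_sets\<close>)
  ultimately show ?thesis by simp
qed

text \<open>Each requirement is visible on corners. Symmetry is that of \<open>homog\<close>; up to
  a null set \<open>corner t 0\<close> is the strip over [0,t], so f 0 = 1/2 gives the first
  marginal, and symmetry the second; scale invariance follows from homogeneity by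
  inclusion-exclusion.\<close>

lemma in_P_star_rho:
  assumes F: "\<And>r s. 0 \<le> r \<Longrightarrow> r \<le> 1 \<Longrightarrow> 0 \<le> s \<Longrightarrow> s \<le> 1 \<Longrightarrow> measure \<mu> (corner r s) = homog f r s"
    and f0: "f 0 = 1 / 2"
  shows "\<mu> \<in> P_star_rho"
proof -
  note S = prob_algebraD(2,3)[OF \<mu>]
  have swap: "distr \<mu> I2_meas (\<lambda>(x, y). (y, x)) = \<mu>"
    by (rule corner_measure_eqI_homog[OF distr_prob_algebra[OF \<mu> swap_measurable] \<mu>, where f=f])
      (simp_all add: measure_swap_corner F homog_commute)
  have null: "corner 0 0 \<in> null_sets \<mu>"
    using F[of 0 0] corner_sets[of 0 0] by (simp add: null_sets_def S emeasure_eq_measure homog_def)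
  have R: "A \<times> I_set \<in> sets \<mu>" if "A \<in> sets I_meas" for A
    unfolding S using that by (auto intro!: rectangle_sets)
  have Icc: "measure \<mu> ({0..ereal t} \<times> I_set) = t / 2" if t: "0 \<le> t" "t \<le> 1" for t
  proof -
    have "measure \<mu> ({0..ereal t} \<times> I_set) = measure \<mu> ({0..ereal t} \<times> I_set \<union> corner 0 0)"
      using measure_Un_null_set[OF R[OF Icc_I_meas] null] t by simp
    also have "{0..ereal t} \<times> I_set \<union> corner 0 0 = corner t 0"
    proof -
      have "{0..ereal 0} \<subseteq> {0..ereal t}" using t by simp
      then show ?thesis unfolding corner_def by blast
    qed
    finally show ?thesis using F[of t 0] t by (simp add: homog_le f0)
  qed
  have fst: "distr \<mu> I_meas fst = rho"
  proof (rule rho_unique)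
    show "prob_space (distr \<mu> I_meas fst)"
      using fst_measurable measurable_cong_sets[OF S(1) refl] by (intro prob_space_distr) blast
    show "measure (distr \<mu> I_meas fst) {0..ereal t} = t / 2" if "0 \<le> t" "t \<le> 1" for t
      using that by (simp add: measure_marginals Icc_I_meas Icc)
    have "{\<infinity>} \<times> I_set = space \<mu> - {0..ereal 1} \<times> I_set"
      by (auto simp: S I_set_def one_ereal_def)
    then show "measure (distr \<mu> I_meas fst) {\<infinity>} = 1 / 2"
      using prob_compl[OF R[OF Icc_I_meas[of 1]]] Icc[of 1] by (simp add: measure_marginals infinity_I_meas)
  qed simp
  have snd: "distr \<mu> I_meas snd = rho"
  proof -
    have m: "(\<lambda>(x, y). (y, x)) \<in> \<mu> \<rightarrow>\<^sub>M I2_meas"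
      using swap_measurable measurable_cong_sets[OF S(1) refl] by blast
    have "distr \<mu> I_meas snd = distr (distr \<mu> I2_meas (\<lambda>(x, y). (y, x))) I_meas fst"
      by (subst distr_distr[OF fst_measurable m]) (auto intro!: distr_cong simp: comp_def)
    then show ?thesis unfolding swap fst .
  qed
  have "measure \<mu> ({0..ereal (t * r)} \<times> {0..ereal (t * s)}) = t * measure \<mu> ({0..ereal r} \<times> {0..ereal s})"
    if "r \<in> {0..1}" "s \<in> {0..1}" "t \<in> {0..1}" for r s t
  proof -
    have "0 \<le> t * r" "t * r \<le> 1" "0 \<le> t * s" "t * s \<le> 1"
      using that by (auto intro: mult_le_one)
    then have 1: "measure \<mu> ({0..ereal (t * r)} \<times> {0..ereal (t * s)}) = t * r / 2 + t * s / 2 - t * homog f r s"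
      using that by (simp only: measure_Icc_Icc[OF fst snd] F homog_scale atLeastAtMost_iff)
    have 2: "measure \<mu> ({0..ereal r} \<times> {0..ereal s}) = r / 2 + s / 2 - homog f r s"
      using that by (simp only: measure_Icc_Icc[OF fst snd] F atLeastAtMost_iff)
    show ?thesis unfolding 1 2 by (simp add: algebra_simps)
  qed
  then show ?thesis using \<mu> swap fst snd by (simp add: P_star_rho_def)
qed

end

text \<open>The set of first arguments that \<open>chi \<tau> 1\<close>, applied in both
  coordinates, sends into \<open>corner r s\<close>.\<close>

definition window :: "real \<Rightarrow> real \<Rightarrow> real \<Rightarrow> (ereal \<times> ereal) set" where
  "window \<tau> r s = {(x, y) \<in> I_set \<times> I_set. ereal \<tau> < x \<and> x \<le> ereal r \<or> ereal \<tau> < y \<and> y \<le> ereal s}"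

text \<open>Truncating \<tau> at r and at s lets one formula cover all \<tau> \<ge> 0: beyond r or s
  the corresponding strip is empty.\<close>

lemma window_eq:
  assumes "0 \<le> \<tau>" "0 \<le> r" "r \<le> 1" "0 \<le> s" "s \<le> 1"
  shows "window \<tau> r s = ({0..ereal r} - {0..ereal (min \<tau> r)}) \<times> I_set \<union> I_set \<times> ({0..ereal s} - {0..ereal (min \<tau> s)})"
proof -
  have "{0..ereal r} - {0..ereal (min \<tau> r)} = {x \<in> I_set. ereal \<tau> < x \<and> x \<le> ereal r}"
    if "0 \<le> r" "r \<le> 1" for r
  proof (cases "\<tau> \<le> r")
    case True
    have "0 \<le> x" if "x \<in> I_set" for x using that by (auto simp: I_set_def)
    moreover have "0 \<le> ereal \<tau>" using assms(1) by simp
    ultimately show ?thesis using True that Icc_subset_I_set[of r] by (auto simp: min_absorb1)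
  next
    case False
    then have "\<not> (ereal \<tau> < x \<and> x \<le> ereal r)" for x
      using order.strict_trans2[of "ereal \<tau>" x "ereal r"] by auto
    then show ?thesis using False by (auto simp: min_def)
  qed
  then show ?thesis using assms by (auto simp: window_def)
qed

lemma window_sets:
  assumes "0 \<le> r" "r \<le> 1" "0 \<le> s" "s \<le> 1"
  shows "window \<tau> r s \<in> sets I2_meas"
proof -
  have "window \<tau> r s = (above (ereal \<tau>) \<inter> {0..ereal r}) \<times> I_set \<union> I_set \<times> (above (ereal \<tau>) \<inter> {0..ereal s})"
    by (auto simp: window_def above_def I_set_def)
  then show ?thesis using assms
    by (auto intro!: rectangle_sets sets.Int above_sets Icc_I_meas)
qed

section \<open>Corner probabilities of measures in the class\<close>

context
  fixes \<mu> :: "(ereal \<times> ereal) measure" and F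
  assumes P: "\<mu> \<in> P_star_rho"
  defines "F \<equiv> \<lambda>r s. measure \<mu> (corner r s)"
begin

lemma P_star_rho_prob_algebra: "\<mu> \<in> space (prob_algebra I2_meas)"
  using P by (simp add: P_star_rho_def)

interpretation prob_space \<mu> by (rule prob_algebraD[OF P_star_rho_prob_algebra])

lemma P_star_rhoD:
  "distr \<mu> I2_meas (\<lambda>(x, y). (y, x)) = \<mu>" "distr \<mu> I_meas fst = rho" "distr \<mu> I_meas snd = rho"
  "r \<in> {0..1} \<Longrightarrow> s \<in> {0..1} \<Longrightarrow> t \<in> {0..1} \<Longrightarrow>
     measure \<mu> ({0..ereal (t * r)} \<times> {0..ereal (t * s)}) = t * measure \<mu> ({0..ereal r} \<times> {0..ereal s})"
  using P unfolding P_star_rho_def by blast+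

lemma Icc_Icc_corner:
  assumes "0 \<le> r" "r \<le> 1" "0 \<le> s" "s \<le> 1"
  shows "measure \<mu> ({0..ereal r} \<times> {0..ereal s}) = r / 2 + s / 2 - F r s"
  unfolding F_def by (rule measure_Icc_Icc[OF P_star_rho_prob_algebra P_star_rhoD(2,3) assms])

lemma marginal_Icc:
  assumes "0 \<le> r" "r \<le> 1"
  shows "measure \<mu> ({0..ereal r} \<times> I_set) = r / 2" "measure \<mu> (I_set \<times> {0..ereal r}) = r / 2"
  using measure_marginals[OF P_star_rho_prob_algebra Icc_I_meas[OF assms(2)]] rho_Icc[OF assms]
  by (simp_all add: P_star_rhoD)

lemma corner_commute:
  assumes "r \<le> 1" "s \<le> 1"
  shows "F r s = F s r"
  using measure_swap_corner[OF P_star_rho_prob_algebra assms] by (simp add: P_star_rhoD F_def)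

text \<open>The marginal \<open>rho\<close> has no atom at 0, so rectangles with a side {0} are null
  and inclusion-exclusion leaves only the strip over [0,r].\<close>

lemma corner_0_0: "F 0 0 = 0"
  and corner_axis: "0 \<le> r \<Longrightarrow> r \<le> 1 \<Longrightarrow> F r 0 = r / 2"
proof -
  note S = prob_algebraD(2)[OF P_star_rho_prob_algebra]
  have 0: "measure \<mu> ({0..ereal r} \<times> {0..ereal 0}) = 0" if "r \<le> 1" for r
  proof -
    have "measure \<mu> ({0..ereal r} \<times> {0..ereal 0}) \<le> measure \<mu> (I_set \<times> {0..ereal 0})"
      using that Icc_subset_I_set[of r] Icc_I_meas[of 0]
      by (intro finite_measure_mono) (auto simp: S intro!: rectangle_sets)
    then show ?thesis using marginal_Icc(2)[of 0] measure_nonneg[of \<mu>] by (metis div_0 order.antisym order_refl zero_le_one)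
  qed
  show "0 \<le> r \<Longrightarrow> r \<le> 1 \<Longrightarrow> F r 0 = r / 2" for r
    using 0[of r] Icc_Icc_corner[of r 0] by simp
  from this[of 0] show "F 0 0 = 0" by simp
qed

text \<open>Scale invariance is stated for rectangles. Inclusion-exclusion moves it to corners,
  because the marginal masses r/2 and s/2 scale in the same way; it is applied with t = r at the
  point (1, s/r).\<close>

lemma corner_homog:
  assumes "0 \<le> r" "r \<le> 1" "0 \<le> s" "s \<le> 1"
  shows "F r s = homog (F 1) r s"
proof -
  have le: "F r s = homog (F 1) r s" if "0 \<le> s" "s \<le> r" "r \<le> 1" for r s
  proof (cases "r = 0")
    case True
    then show ?thesis using that corner_0_0 by (simp add: homog_def)
  next
    case False
    then have r: "0 < r" using that by simp
    have "s / r \<in> {0..1}" using that r by simp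
    then have "measure \<mu> ({0..ereal (r * 1)} \<times> {0..ereal (r * (s / r))})
      = r * measure \<mu> ({0..ereal 1} \<times> {0..ereal (s / r)})"
      using r that by (intro P_star_rhoD(4)) auto
    then have "r / 2 + s / 2 - F r s = r * (1 / 2 + s / r / 2 - F 1 (s / r))"
      using r that \<open>s / r \<in> {0..1}\<close> by (simp add: Icc_Icc_corner del: ereal_eq_1)
    then show ?thesis using r that by (simp add: homog_le algebra_simps)
  qed
  show ?thesis
    using le[of s r] le[of r s] corner_commute[of r s] homog_commute[of "F 1" r s] assms by linarith
qed

lemma corner_measure_mono: "r \<le> r' \<Longrightarrow> r' \<le> 1 \<Longrightarrow> s \<le> s' \<Longrightarrow> s' \<le> 1 \<Longrightarrow> F r s \<le> F r' s'"
  unfolding F_def using corner_sets[of r' s']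
  by (intro finite_measure_mono corner_mono) (auto simp: prob_algebraD(2)[OF P_star_rho_prob_algebra])

text \<open>The increment of F is that of the marginal, of density 1/2, minus the increment of a
  rectangle mass, which is nonnegative.\<close>

lemma corner_measure_lipschitz:
  assumes "0 \<le> r" "r \<le> r'" "r' \<le> 1" "0 \<le> s" "s \<le> 1"
  shows "F r' s \<le> F r s + (r' - r) / 2"
proof -
  have "measure \<mu> ({0..ereal r} \<times> {0..ereal s}) \<le> measure \<mu> ({0..ereal r'} \<times> {0..ereal s})"
    using assms by (intro finite_measure_mono Sigma_mono)
      (auto simp: prob_algebraD(2)[OF P_star_rho_prob_algebra] intro!: rectangle_sets Icc_I_meas)
  then show ?thesis using assms by (simp add: Icc_Icc_corner field_simps)
qed

text \<open>Continuity makes the integral of the profile differentiable later on. The Lipschitz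
  bound in the first variable passes to the second by symmetry.\<close>

lemma corner_measure_continuous: "continuous_on ({0..1} \<times> {0..1}) (\<lambda>(r, s). F r s)"
proof -
  have 1: "\<bar>F r s - F r' s\<bar> \<le> \<bar>r - r'\<bar> / 2" if "r \<in> {0..1}" "r' \<in> {0..1}" "s \<in> {0..1}" for r r' s
  proof (cases "r \<le> r'")
    case True
    then have "F r' s \<le> F r s + (r' - r) / 2" "F r s \<le> F r' s"
      using that corner_measure_lipschitz[of r r' s] corner_measure_mono[of r r' s s] by auto
    moreover have "\<bar>r - r'\<bar> = r' - r" using True by simp
    ultimately show ?thesis by (simp only: abs_le_iff) (simp add: field_simps)
  next
    case False
    then have "F r s \<le> F r' s + (r - r') / 2" "F r' s \<le> F r s"
      using that corner_measure_lipschitz[of r' r s] corner_measure_mono[of r' r s s] by auto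
    moreover have "\<bar>r - r'\<bar> = r - r'" using False by simp
    ultimately show ?thesis by (simp only: abs_le_iff) (simp add: field_simps)
  qed
  have 2: "\<bar>F r s - F r' s'\<bar> \<le> dist (r, s) (r', s')"
    if "r \<in> {0..1}" "r' \<in> {0..1}" "s \<in> {0..1}" "s' \<in> {0..1}" for r r' s s'
  proof -
    have gen: "z \<le> d" if "z \<le> x + y" "x \<le> a / 2" "y \<le> b / 2" "a \<le> d" "b \<le> d" for a b d x y z :: real
      using that by linarith
    have "\<bar>F s r' - F s' r'\<bar> \<le> \<bar>s - s'\<bar> / 2" using 1 that by auto
    moreover have "F s r' = F r' s" "F s' r' = F r' s'" using corner_commute that by auto
    ultimately have sy: "\<bar>F r' s - F r' s'\<bar> \<le> \<bar>s - s'\<bar> / 2" by simp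
    show ?thesis
    proof (rule gen[OF _ 1 sy])
      show "\<bar>F r s - F r' s'\<bar> \<le> \<bar>F r s - F r' s\<bar> + \<bar>F r' s - F r' s'\<bar>"
        using abs_triangle_ineq[of "F r s - F r' s" "F r' s - F r' s'"] by simp
      show "\<bar>r - r'\<bar> \<le> dist (r, s) (r', s')" "\<bar>s - s'\<bar> \<le> dist (r, s) (r', s')"
        using dist_fst_le[of "(r, s)" "(r', s')"] dist_snd_le[of "(r, s)" "(r', s')"]
        by (simp_all add: dist_real_def)
    qed (use that in auto)
  qed
  show ?thesis
    unfolding continuous_on_iff
  proof (intro ballI allI impI)
    fix x :: "real \<times> real" and e :: real assume x: "x \<in> {0..1} \<times> {0..1}" and e: "0 < e"
    show "\<exists>d>0. \<forall>x'\<in>{0..1} \<times> {0..1}. dist x' x < d \<longrightarrow>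
       dist (case x' of (r, s) \<Rightarrow> F r s) (case x of (r, s) \<Rightarrow> F r s) < e"
    proof (intro exI[of _ e] conjI ballI impI e)
      fix x' :: "real \<times> real" assume x': "x' \<in> {0..1} \<times> {0..1}" "dist x' x < e"
      show "dist (case x' of (r, s) \<Rightarrow> F r s) (case x of (r, s) \<Rightarrow> F r s) < e"
        using 2[of "fst x'" "fst x" "snd x'" "snd x"] x x'
        by (auto simp: dist_real_def case_prod_beta)
    qed
  qed
qed

text \<open>Inclusion-exclusion for the union of two strips; the mass of the rectangle in which they
  meet is minus a second difference of F.\<close>

lemma window_measure:
  assumes \<tau>: "0 \<le> \<tau>" and r: "0 \<le> r" "r \<le> 1" and s: "0 \<le> s" "s \<le> 1"
  shows "measure \<mu> (window \<tau> r s) = (r - min \<tau> r) / 2 + (s - min \<tau> s) / 2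
    + F r s - F (min \<tau> r) s - F r (min \<tau> s) + F (min \<tau> r) (min \<tau> s)"
proof -
  define r' s' where "r' = min \<tau> r" and "s' = min \<tau> s"
  have rs: "0 \<le> r'" "r' \<le> r" "r' \<le> 1" "0 \<le> s'" "s' \<le> s" "s' \<le> 1"
    using assms by (auto simp: r'_def s'_def)
  define J where "J a = {0..ereal a}" for a
  have Js: "J a \<in> sets I_meas" if "a \<le> 1" for a using that by (simp add: J_def Icc_I_meas)
  have Jm: "J a \<subseteq> J b" if "a \<le> b" for a b using that by (auto simp: J_def)
  have R: "A \<times> B \<in> sets \<mu>" if "A \<in> sets I_meas" "B \<in> sets I_meas" for A B
    unfolding prob_algebraD(2)[OF P_star_rho_prob_algebra] using that by (rule rectangle_sets)
  have dX: "measure \<mu> ((J r - J r') \<times> I_set) = (r - r') / 2"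
  proof -
    have "(J r - J r') \<times> I_set = J r \<times> I_set - J r' \<times> I_set" by auto
    moreover have "J r' \<times> I_set \<subseteq> J r \<times> I_set" using Jm[of r' r] rs by auto
    ultimately have "measure \<mu> ((J r - J r') \<times> I_set) = measure \<mu> (J r \<times> I_set) - measure \<mu> (J r' \<times> I_set)"
      using finite_measure_Diff[of "J r \<times> I_set" "J r' \<times> I_set"] rs r by (simp add: R Js)
    then show ?thesis
      using marginal_Icc(1)[of r] marginal_Icc(1)[of r'] rs r by (simp add: J_def diff_divide_distrib)
  qed
  have row: "measure \<mu> (A \<times> (J s - J s')) = measure \<mu> (A \<times> J s) - measure \<mu> (A \<times> J s')" if "A \<in> sets I_meas" for A
  proof -
    have "A \<times> (J s - J s') = A \<times> J s - A \<times> J s'" by auto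
    moreover have "A \<times> J s' \<subseteq> A \<times> J s" using Jm[of s' s] rs by auto
    ultimately show ?thesis
      using finite_measure_Diff[of "A \<times> J s" "A \<times> J s'"] rs s that by (simp add: R Js)
  qed
  have dY: "measure \<mu> (I_set \<times> (J s - J s')) = (s - s') / 2"
    using row[of I_set] marginal_Icc(2)[of s] marginal_Icc(2)[of s'] rs s by (simp add: J_def diff_divide_distrib)
  have dXY: "measure \<mu> ((J r - J r') \<times> (J s - J s')) =
     measure \<mu> (J r \<times> J s) - measure \<mu> (J r \<times> J s') - (measure \<mu> (J r' \<times> J s) - measure \<mu> (J r' \<times> J s'))"
  proof -
    have "(J r - J r') \<times> (J s - J s') = J r \<times> (J s - J s') - J r' \<times> (J s - J s')" by auto
    moreover have "J r' \<times> (J s - J s') \<subseteq> J r \<times> (J s - J s')" using Jm[of r' r] rs by auto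
    ultimately show ?thesis
      using finite_measure_Diff[of "J r \<times> (J s - J s')" "J r' \<times> (J s - J s')"] rs r s
      by (simp add: R Js sets.Diff row)
  qed
  have "J r \<subseteq> I_set" "J s \<subseteq> I_set" unfolding J_def using Icc_subset_I_set r s by auto
  then have "((J r - J r') \<times> I_set) \<inter> (I_set \<times> (J s - J s')) = (J r - J r') \<times> (J s - J s')" by auto
  moreover have "measure \<mu> (window \<tau> r s) = measure \<mu> ((J r - J r') \<times> I_set) + measure \<mu> (I_set \<times> (J s - J s'))
     - measure \<mu> (((J r - J r') \<times> I_set) \<inter> (I_set \<times> (J s - J s')))"
    unfolding window_eq[OF assms] r'_def[symmetric] s'_def[symmetric] J_def[symmetric]
    by (rule measure_Un3) (use r s rs in \<open>auto simp: fmeasurable_eq_sets R Js sets.Diff\<close>)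
  ultimately have "measure \<mu> (window \<tau> r s) = (r - r') / 2 + (s - s') / 2 - measure \<mu> ((J r - J r') \<times> (J s - J s'))"
    by (simp add: dX dY)
  also have "measure \<mu> ((J r - J r') \<times> (J s - J s')) = - F r s + F r s' + F r' s - F r' s'"
    unfolding dXY unfolding J_def using Icc_Icc_corner rs r s by simp
  finally show ?thesis by (simp add: r'_def s'_def)
qed

end

section \<open>The bivariate map\<close>

text \<open>Condition on k. For k = 1 only the first pair matters, and it must lie in the window;
  for k = 2 the minimum misses the corner exactly when both independent pairs miss it. The average
  over \<tau> stays abstract as G.\<close>

lemma T2_corner:
  assumes P: "\<mu> \<in> P_star_rho" and r: "0 \<le> r" "r \<le> 1" and s: "0 \<le> s" "s \<le> 1"
    and G: "((\<lambda>\<tau>. measure \<mu> (window \<tau> r s)) has_integral G) {0..1}"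
  shows "measure (T2 \<mu>) (corner r s) = G / 2 + (1 - (1 - measure \<mu> (corner r s))\<^sup>2) / 2"
proof -
  define U where "U = uniform_measure lborel {0..1::real}"
  define K where "K = uniform_count_measure {1, 2::nat}"
  define h where "h = (\<lambda>((\<tau>, k), ((y1, y1'), (y2, y2'))). (chi \<tau> k y1 y2, chi \<tau> k y1' y2'))"
  note \<mu> = P_star_rho_prob_algebra[OF P]
  note S = prob_algebraD(2,3)[OF \<mu>]
  interpret m: prob_space \<mu> by (rule prob_algebraD[OF \<mu>])
  interpret mm: pair_prob_space \<mu> \<mu> ..
  interpret U: prob_space U unfolding U_def by (rule prob_space_uniform_measure) auto
  interpret K: prob_space K unfolding K_def by (rule prob_space_uniform_count_measure) auto
  have spU: "space U = UNIV" by (simp add: U_def)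
  have spK: "space K = {1, 2}" by (simp add: K_def space_uniform_count_measure)
  define X where "X = h -` corner r s \<inter> space ((U \<Otimes>\<^sub>M K) \<Otimes>\<^sub>M (\<mu> \<Otimes>\<^sub>M \<mu>))"
  have hm: "h \<in> (U \<Otimes>\<^sub>M K) \<Otimes>\<^sub>M (\<mu> \<Otimes>\<^sub>M \<mu>) \<rightarrow>\<^sub>M I2_meas"
    unfolding U_def K_def h_def by (rule T2_map_measurable[OF S(1)])
  have C: "corner r s \<in> sets I2_meas" using r s by (simp add: corner_sets)
  have X: "X \<in> sets ((U \<Otimes>\<^sub>M K) \<Otimes>\<^sub>M (\<mu> \<Otimes>\<^sub>M \<mu>))"
    unfolding X_def using hm C by (rule measurable_sets)
  define \<phi> where "\<phi> z = emeasure (\<mu> \<Otimes>\<^sub>M \<mu>) (Pair z -` X)" for z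
  have \<phi>: "\<phi> \<in> borel_measurable (U \<Otimes>\<^sub>M K)"
    unfolding \<phi>_def using X by (rule mm.measurable_emeasure_Pair)
  define m where "m \<tau> = measure \<mu> (window \<tau> r s)" for \<tau>
  define F where "F = measure \<mu> (corner r s)"
  define q where "q = 1 - (1 - F)\<^sup>2"
  have F: "0 \<le> F" "F \<le> 1" by (simp_all add: F_def)
  have q: "0 \<le> q" using F by (simp add: q_def power_le_one)
  have m0: "0 \<le> m \<tau>" for \<tau> by (simp add: m_def)
  have corner_iff: "(a, b) \<in> corner r s \<longleftrightarrow> a \<le> ereal r \<or> b \<le> ereal s" if "a \<in> I_set" "b \<in> I_set" for a b
    using that by (auto simp: corner_def I_set_def)
  have sp: "((\<tau>, k), (w1, w2)) \<in> space ((U \<Otimes>\<^sub>M K) \<Otimes>\<^sub>M (\<mu> \<Otimes>\<^sub>M \<mu>)) \<longleftrightarrow>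
      (k = 1 \<or> k = 2) \<and> w1 \<in> I_set \<times> I_set \<and> w2 \<in> I_set \<times> I_set" for \<tau> k w1 w2
    by (simp add: space_pair_measure spU spK S)
  have slice1: "Pair (\<tau>, 1) -` X = window \<tau> r s \<times> space \<mu>" for \<tau>
  proof -
    have "w \<in> Pair (\<tau>, 1) -` X \<longleftrightarrow> w \<in> window \<tau> r s \<times> space \<mu>" for w
    proof -
      obtain a b c d where w: "w = ((a, b), (c, d))" by (metis surj_pair)
      show ?thesis
        using chi_in_I_set[of a c \<tau> 1] chi_in_I_set[of b d \<tau> 1]
        by (auto simp: w X_def sp S h_def corner_iff window_def chi_def split: if_splits)
    qed
    then show ?thesis by blast
  qed
  have slice2: "Pair (\<tau>, 2) -` X = space (\<mu> \<Otimes>\<^sub>M \<mu>) - (space \<mu> - corner r s) \<times> (space \<mu> - corner r s)" for \<tau>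
  proof -
    have "w \<in> Pair (\<tau>, 2) -` X \<longleftrightarrow> w \<in> space (\<mu> \<Otimes>\<^sub>M \<mu>) - (space \<mu> - corner r s) \<times> (space \<mu> - corner r s)" for w
    proof -
      obtain a b c d where w: "w = ((a, b), (c, d))" by (metis surj_pair)
      show ?thesis
        using chi_in_I_set[of a c \<tau> 2] chi_in_I_set[of b d \<tau> 2]
        by (auto simp: w X_def sp S h_def corner_iff chi_def space_pair_measure min_le_iff_disj spU spK)
    qed
    then show ?thesis by blast
  qed
  have \<phi>1: "\<phi> (\<tau>, 1) = ennreal (m \<tau>)" for \<tau>
  proof -
    have "window \<tau> r s \<in> sets \<mu>" using window_sets[OF r s] by (simp add: S)
    then have "\<phi> (\<tau>, 1) = emeasure \<mu> (window \<tau> r s) * emeasure \<mu> (space \<mu>)"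
      unfolding \<phi>_def slice1 by (intro m.emeasure_pair_measure_Times sets.top)
    also have "\<dots> = ennreal (m \<tau>)"
      unfolding m.emeasure_space_1 by (simp add: m.emeasure_eq_measure m_def)
    finally show ?thesis .
  qed
  have \<phi>2: "\<phi> (\<tau>, 2) = ennreal q" for \<tau>
  proof -
    have D: "space \<mu> - corner r s \<in> sets \<mu>" using C by (simp add: S(1) sets.compl_sets flip: S(1))
    have "mm.prob ((space \<mu> - corner r s) \<times> (space \<mu> - corner r s)) = (1 - F) * (1 - F)"
      using m.emeasure_pair_measure_Times[OF D D] D C
      by (simp add: mm.emeasure_eq_measure m.emeasure_eq_measure m.prob_compl S(1) F_def flip: ennreal_mult)
    then have "mm.prob (Pair (\<tau>, 2) -` X) = q"
      unfolding slice2 using D by (subst mm.prob_compl) (auto simp: q_def power2_eq_square)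
    then show ?thesis by (simp add: \<phi>_def mm.emeasure_eq_measure)
  qed
  \<comment> \<open>Measurability in \<tau> is read off the section measures at k = 1.\<close>
  have [measurable]: "m \<in> borel_measurable borel"
  proof -
    have "(\<lambda>\<tau>. (\<tau>, 1)) \<in> U \<rightarrow>\<^sub>M U \<Otimes>\<^sub>M K" by (rule measurable_Pair2') (simp add: spK)
    then have "(\<lambda>\<tau>. enn2real (\<phi> (\<tau>, 1))) \<in> borel_measurable U"
      using \<phi> by (intro borel_measurable_enn2real) (rule measurable_compose)
    then show ?thesis unfolding \<phi>1 U_def by (simp add: m0 cong: measurable_cong_sets)
  qed
  have "emeasure (T2 \<mu>) (corner r s) = emeasure ((U \<Otimes>\<^sub>M K) \<Otimes>\<^sub>M (\<mu> \<Otimes>\<^sub>M \<mu>)) X"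
    unfolding T2_def h_def[symmetric] U_def[symmetric] K_def[symmetric] X_def
    by (rule emeasure_distr[OF hm C])
  also have "\<dots> = (\<integral>\<^sup>+z. \<phi> z \<partial>(U \<Otimes>\<^sub>M K))"
    unfolding \<phi>_def by (rule mm.emeasure_pair_measure_alt[OF X])
  also have "\<dots> = (\<integral>\<^sup>+\<tau>. \<integral>\<^sup>+k. \<phi> (\<tau>, k) \<partial>K \<partial>U)"
    by (rule K.nn_integral_fst[OF \<phi>, symmetric])
  also have "\<dots> = (\<integral>\<^sup>+\<tau>. ennreal ((m \<tau> + q) / 2) \<partial>U)"
  proof (rule nn_integral_cong)
    fix \<tau>
    have "(\<integral>\<^sup>+k. \<phi> (\<tau>, k) \<partial>K) = ennreal (1 / 2) * \<phi> (\<tau>, 1) + ennreal (1 / 2) * \<phi> (\<tau>, 2)"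
      unfolding K_def uniform_count_measure_def by (subst nn_integral_point_measure_finite) auto
    also have "\<dots> = ennreal ((m \<tau> + q) / 2)"
    proof -
      have "ennreal (1 / 2) * ennreal x = ennreal (x / 2)" if "0 \<le> x" for x :: real
        using that by (subst ennreal_mult[symmetric]) auto
      then show ?thesis
        unfolding \<phi>1 \<phi>2 using m0[of \<tau>] q
        by (simp only: add_divide_distrib) (simp add: ennreal_plus)
    qed
    finally show "(\<integral>\<^sup>+k. \<phi> (\<tau>, k) \<partial>K) = ennreal ((m \<tau> + q) / 2)" .
  qed
  also have "\<dots> = (\<integral>\<^sup>+\<tau>. ennreal ((m \<tau> + q) / 2) * indicator {0..1} \<tau> \<partial>lborel)"
    unfolding U_def by (subst nn_integral_uniform_measure) (auto simp: divide_ennreal_def)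
  also have "\<dots> = (\<integral>\<^sup>+\<tau>. ennreal (if \<tau> \<in> {0..1} then (m \<tau> + q) / 2 else 0) \<partial>lborel)"
    by (intro nn_integral_cong) (auto simp: indicator_def)
  also have "\<dots> = ennreal ((G + q) / 2)"
  proof (rule nn_integral_has_integral_lborel)
    have "((\<lambda>_. q) has_integral q) {0..1::real}" using has_integral_const_real[of q 0 1] by simp
    then have "((\<lambda>\<tau>. (m \<tau> + q) / 2) has_integral (G + q) / 2) {0..1}"
      unfolding m_def by (intro has_integral_divide has_integral_add G)
    then show "((\<lambda>\<tau>. if \<tau> \<in> {0..1} then (m \<tau> + q) / 2 else 0) has_integral (G + q) / 2) UNIV"
      by (simp only: has_integral_restrict_UNIV)
  qed (use m0 q in auto)
  finally have "emeasure (T2 \<mu>) (corner r s) = ennreal ((G + q) / 2)" .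
  moreover have "0 \<le> G" using has_integral_nonneg[OF G] by simp
  ultimately have "measure (T2 \<mu>) (corner r s) = (G + q) / 2"
    using q by (simp add: measure_def)
  then show ?thesis by (simp add: q_def F_def add_divide_distrib)
qed

text \<open>For s \<le> r the integrand has three regimes. Up to s both strips contribute; between s
  and r only the first one is left, of mass (r - \<tau>) / 2; beyond r there is nothing.\<close>

lemma window_has_integral:
  fixes \<mu> defines "F \<equiv> \<lambda>r s. measure \<mu> (corner r s)"
  defines "\<Phi> \<equiv> \<lambda>x. integral {0..x} (F 1)"
  assumes P: "\<mu> \<in> P_star_rho" and s: "0 \<le> s" "s \<le> r" and r: "0 < r" "r \<le> 1"
  shows "((\<lambda>\<tau>. measure \<mu> (window \<tau> r s)) has_integral
     (r\<^sup>2 + s\<^sup>2) / 4 + s * F r s - s\<^sup>2 * \<Phi> 1 - r\<^sup>2 * \<Phi> (s / r) + s\<^sup>2 / 2 * F 1 1) {0..1}"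
proof -
  have W: "measure \<mu> (window \<tau> r s) = (r - min \<tau> r) / 2 + (s - min \<tau> s) / 2
      + F r s - F (min \<tau> r) s - F r (min \<tau> s) + F (min \<tau> r) (min \<tau> s)"
    if "0 \<le> \<tau>" "0 \<le> r" "r \<le> 1" "0 \<le> s" "s \<le> 1" for \<tau> r s
    unfolding F_def by (rule window_measure[OF P that])
  have hom: "F a b = homog (F 1) a b" if "0 \<le> a" "a \<le> 1" "0 \<le> b" "b \<le> 1" for a b
    using corner_homog[OF P that] by (simp add: F_def)
  have "continuous_on {0..1} (F 1)"
  proof -
    have "continuous_on {0..1} ((\<lambda>(r, s). F r s) \<circ> (\<lambda>s. (1, s)))"
      by (rule continuous_on_compose)
        (auto intro!: continuous_intros continuous_on_subset[OF corner_measure_continuous[OF P, folded F_def]])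
    then show ?thesis by (simp add: comp_def)
  qed
  then have D\<Phi>: "(\<Phi> has_real_derivative F 1 x) (at x within {0..1})" if "x \<in> {0..1}" for x
    unfolding \<Phi>_def using that by (rule integral_has_real_derivative)
  have chain: "((\<lambda>\<tau>. \<Phi> (\<tau> / a)) has_real_derivative F 1 (x / a) / a) (at x within {0..s})"
    if "0 < a" "s \<le> a" "x \<in> {0..s}" for a x
  proof -
    have "(\<Phi> has_real_derivative F 1 (x / a)) (at (x / a) within (\<lambda>x. x / a) ` {0..s})"
      using that by (intro DERIV_subset[OF D\<Phi>]) (auto simp: divide_simps)
    moreover have "((\<lambda>x. x / a) has_real_derivative 1 / a) (at x within {0..s})"
      using that by (auto intro!: derivative_eq_intros)
    ultimately show ?thesis using DERIV_image_chain[of \<Phi> _ "\<lambda>x. x / a"] by (force simp: comp_def)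
  qed
  have I1: "((\<lambda>\<tau>. measure \<mu> (window \<tau> r s)) has_integral
     r * s / 2 + s * F r s - s\<^sup>2 * \<Phi> 1 - r\<^sup>2 * \<Phi> (s / r) + s\<^sup>2 / 2 * F 1 1) {0..s}"
  proof (cases "s = 0")
    case True
    moreover have "((\<lambda>\<tau>. measure \<mu> (window \<tau> r s)) has_integral 0) (cbox 0 0)"
      by (rule has_integral_refl)
    ultimately show ?thesis by (simp add: \<Phi>_def)
  next
    case False
    then have s0: "0 < s" using s by simp
    \<comment> \<open>By homogeneity F \<tau> s = s F 1 (\<tau>/s) and F r \<tau> = r F 1
      (\<tau>/r); the substitutions \<tau>/s and \<tau>/r produce the two \<Phi> terms. The division
      by s is why s = 0 is treated apart.\<close>
    define A where "A \<tau> = (r + s) / 2 * \<tau> - \<tau>\<^sup>2 / 2 + F r s * \<tau> - s\<^sup>2 * \<Phi> (\<tau> / s) - r\<^sup>2 * \<Phi> (\<tau> / r) + \<tau>\<^sup>2 / 2 * F 1 1" for \<tau>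
    define g where "g \<tau> = (r + s) / 2 - \<tau> + F r s - s * F 1 (\<tau> / s) - r * F 1 (\<tau> / r) + \<tau> * F 1 1" for \<tau>
    have "(A has_real_derivative g x) (at x within {0..s})" if x: "x \<in> {0..s}" for x
    proof -
      have 0: "((\<lambda>\<tau>. (r + s) / 2 * \<tau> - \<tau>\<^sup>2 / 2 + F r s * \<tau>) has_real_derivative (r + s) / 2 - x + F r s) (at x within {0..s})"
        and 3: "((\<lambda>\<tau>. \<tau>\<^sup>2 / 2 * F 1 1) has_real_derivative x * F 1 1) (at x within {0..s})"
        by (auto intro!: derivative_eq_intros)
      note 1 = DERIV_cmult[OF chain[OF s0 order_refl x], of "s\<^sup>2"]
      note 2 = DERIV_cmult[OF chain[OF r(1) s(2) x], of "r\<^sup>2"]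
      have "s\<^sup>2 * (F 1 (x / s) / s) = s * F 1 (x / s)" "r\<^sup>2 * (F 1 (x / r) / r) = r * F 1 (x / r)"
        using s0 r by (simp_all add: power2_eq_square)
      then show ?thesis
        using DERIV_add[OF DERIV_diff[OF DERIV_diff[OF 0 1] 2] 3] unfolding A_def[abs_def] g_def by simp
    qed
    then have "(g has_integral A s - A 0) {0..s}"
      using s by (intro fundamental_theorem_of_calculus) (auto simp: has_real_derivative_iff_has_vector_derivative[symmetric])
    moreover have "A s - A 0 = r * s / 2 + s * F r s - s\<^sup>2 * \<Phi> 1 - r\<^sup>2 * \<Phi> (s / r) + s\<^sup>2 / 2 * F 1 1"
      using s0 by (simp add: A_def \<Phi>_def power2_eq_square field_simps)
    moreover have "g \<tau> = measure \<mu> (window \<tau> r s)" if \<tau>: "\<tau> \<in> {0..s}" for \<tau>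
    proof -
      have "F \<tau> s = s * F 1 (\<tau> / s)" "F r \<tau> = r * F 1 (\<tau> / r)" "F \<tau> \<tau> = \<tau> * F 1 1"
        using hom[of \<tau> s] hom[of r \<tau>] hom[of \<tau> \<tau>] s r \<tau> homog_commute[of "F 1" \<tau> s] 
        by (auto simp: homog_le)
      then show ?thesis using W[of \<tau> r s] \<tau> s r by (simp add: g_def min_absorb1 field_simps)
    qed
    ultimately show ?thesis by (metis (no_types, lifting) has_integral_cong)
  qed
  have I2: "((\<lambda>\<tau>. measure \<mu> (window \<tau> r s)) has_integral (r - s)\<^sup>2 / 4) {s..r}"
  proof -
    have i: "((\<lambda>\<tau>. (r - \<tau>) / 2) has_integral (- ((r - r)\<^sup>2 / 4)) - (- ((r - s)\<^sup>2 / 4))) {s..r}"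
      using s by (intro fundamental_theorem_of_calculus)
        (auto simp: has_real_derivative_iff_has_vector_derivative[symmetric] field_simps intro!: derivative_eq_intros)
    have e: "(r - \<tau>) / 2 = measure \<mu> (window \<tau> r s)" if "\<tau> \<in> {s..r}" for \<tau>
      using W[of \<tau> r s] that s r by (simp add: min_absorb1 min_absorb2)
    show ?thesis using has_integral_eq[OF e i] by simp
  qed
  have I3: "((\<lambda>\<tau>. measure \<mu> (window \<tau> r s)) has_integral 0) {r..1}"
  proof (rule has_integral_is_0)
    show "measure \<mu> (window \<tau> r s) = 0" if "\<tau> \<in> {r..1}" for \<tau>
      using W[of \<tau> r s] that s r by (simp add: min_absorb2)
  qed
  have I: "((\<lambda>\<tau>. measure \<mu> (window \<tau> r s)) has_integral
     ((r * s / 2 + s * F r s - s\<^sup>2 * \<Phi> 1 - r\<^sup>2 * \<Phi> (s / r) + s\<^sup>2 / 2 * F 1 1) + (r - s)\<^sup>2 / 4) + 0) {0..1}"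
    using s r by (intro has_integral_combine[OF _ _ has_integral_combine[OF _ _ I1 I2] I3]) auto
  have e: "((r * s / 2 + s * F r s - s\<^sup>2 * \<Phi> 1 - r\<^sup>2 * \<Phi> (s / r) + s\<^sup>2 / 2 * F 1 1) + (r - s)\<^sup>2 / 4) + 0
    = (r\<^sup>2 + s\<^sup>2) / 4 + s * F r s - s\<^sup>2 * \<Phi> 1 - r\<^sup>2 * \<Phi> (s / r) + s\<^sup>2 / 2 * F 1 1"
    by (simp add: power2_eq_square field_simps)
  show ?thesis using I unfolding e .
qed

text \<open>On each corner, F = G/2 + (1 - (1 - F)^2)/2 is the same as F^2 = G. Both sides of F^2 =
  G are homogeneous of degree 2, so the case r = 1 suffices.\<close>

lemma fixed_point_iff:
  fixes \<mu> defines "F \<equiv> \<lambda>r s. measure \<mu> (corner r s)"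
  defines "\<Phi> \<equiv> \<lambda>x. integral {0..x} (F 1)"
  assumes P: "\<mu> \<in> P_star_rho"
  shows "T2 \<mu> = \<mu> \<longleftrightarrow> (\<forall>x\<in>{0..1}.
    (F 1 x)\<^sup>2 = (1 + x\<^sup>2) / 4 + x * F 1 x - x\<^sup>2 * \<Phi> 1 - \<Phi> x + x\<^sup>2 / 2 * F 1 1)"
proof -
  define G where "G r s = (r\<^sup>2 + s\<^sup>2) / 4 + s * F r s - s\<^sup>2 * \<Phi> 1 - r\<^sup>2 * \<Phi> (s / r) + s\<^sup>2 / 2 * F 1 1" for r s
  have W: "((\<lambda>\<tau>. measure \<mu> (window \<tau> r s)) has_integral G r s) {0..1}"
    if "0 \<le> s" "s \<le> r" "0 < r" "r \<le> 1" for r s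
    using window_has_integral[OF P that] unfolding G_def \<Phi>_def F_def .
  have sym: "F r s = F s r" if "r \<le> 1" "s \<le> 1" for r s
    unfolding F_def by (rule corner_commute[OF P that])
  have hom: "F r s = homog (F 1) r s" if "0 \<le> r" "r \<le> 1" "0 \<le> s" "s \<le> 1" for r s
    unfolding F_def by (rule corner_homog[OF P that])
  have T: "measure (T2 \<mu>) (corner r s) = F r s \<longleftrightarrow> (F r s)\<^sup>2 = g"
    if "0 \<le> r" "r \<le> 1" "0 \<le> s" "s \<le> 1"
      "((\<lambda>\<tau>. measure \<mu> (window \<tau> r s)) has_integral g) {0..1}" for r s g
  proof -
    have "measure (T2 \<mu>) (corner r s) = g / 2 + (1 - (1 - F r s)\<^sup>2) / 2"
      using T2_corner[OF P that] by (simp add: F_def)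
    then show ?thesis by (auto simp: power2_eq_square field_simps)
  qed
  show ?thesis
  proof
    assume fp: "T2 \<mu> = \<mu>"
    show "\<forall>x\<in>{0..1}. (F 1 x)\<^sup>2 = (1 + x\<^sup>2) / 4 + x * F 1 x - x\<^sup>2 * \<Phi> 1 - \<Phi> x + x\<^sup>2 / 2 * F 1 1"
    proof
      fix x :: real assume x: "x \<in> {0..1}"
      have "measure (T2 \<mu>) (corner 1 x) = F 1 x" by (simp add: fp F_def)
      then have "(F 1 x)\<^sup>2 = G 1 x" using T[OF _ _ _ _ W[of x 1]] x by simp
      then show "(F 1 x)\<^sup>2 = (1 + x\<^sup>2) / 4 + x * F 1 x - x\<^sup>2 * \<Phi> 1 - \<Phi> x + x\<^sup>2 / 2 * F 1 1"
        by (simp add: G_def)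
    qed
  next
    assume eq: "\<forall>x\<in>{0..1}. (F 1 x)\<^sup>2 = (1 + x\<^sup>2) / 4 + x * F 1 x - x\<^sup>2 * \<Phi> 1 - \<Phi> x + x\<^sup>2 / 2 * F 1 1"
    have sq: "(F r s)\<^sup>2 = G r s" if "0 \<le> s" "s \<le> r" "0 < r" "r \<le> 1" for r s
    proof -
      define x where "x = s / r"
      have x: "x \<in> {0..1}" "s = r * x" using that by (auto simp: x_def)
      have Frs: "F r s = r * F 1 x" using hom[of r s] that by (simp add: homog_le x_def)
      have "(F r s)\<^sup>2 = r\<^sup>2 * (F 1 x)\<^sup>2" by (simp add: Frs power_mult_distrib)
      also have "\<dots> = r\<^sup>2 * ((1 + x\<^sup>2) / 4 + x * F 1 x - x\<^sup>2 * \<Phi> 1 - \<Phi> x + x\<^sup>2 / 2 * F 1 1)"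
        using eq x by simp
      also have "\<dots> = G r s"
        unfolding G_def Frs x_def[symmetric] by (simp add: x(2) power2_eq_square algebra_simps)
      finally show ?thesis .
    qed
    have "measure (T2 \<mu>) (corner r s) = F r s" if rs: "0 \<le> r" "r \<le> 1" "0 \<le> s" "s \<le> 1" for r s
    proof -
      consider "0 < r" "s \<le> r" | "0 < s" "r \<le> s" | "r = 0" "s = 0" using rs by linarith
      then show ?thesis
      proof cases
        case 1
        then show ?thesis using T[OF rs W[of s r]] sq[of s r] rs by simp
      next
        case 2
        \<comment> \<open>Symmetry of F gives the two windows equal mass, so the integral computed
          for the opposite order of r and s can be reused.\<close>
        have "measure \<mu> (window \<tau> s r) = measure \<mu> (window \<tau> r s)" if "\<tau> \<in> {0..1}" for \<tau>
          using that rs window_measure[OF P, of \<tau> r s] window_measure[OF P, of \<tau> s r]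
            sym[of r s] sym[of "min \<tau> r" s] sym[of r "min \<tau> s"] sym[of "min \<tau> r" "min \<tau> s"]
          by (simp add: F_def min.coboundedI2)
        then have "((\<lambda>\<tau>. measure \<mu> (window \<tau> r s)) has_integral G s r) {0..1}"
          by (rule has_integral_eq) (use W[of r s] 2 rs in auto)
        then show ?thesis using T[OF rs] sq[of r s] sym[of r s] 2 rs by simp
      next
        case 3
        have "measure \<mu> (window \<tau> 0 0) = 0" if "\<tau> \<in> {0..1}" for \<tau>
          using that window_measure[OF P, of \<tau> 0 0] by simp
        then have "((\<lambda>\<tau>. measure \<mu> (window \<tau> 0 0)) has_integral 0) {0..1}"
          by (rule has_integral_is_0)
        then show ?thesis using T[of 0 0 0] hom[of 0 0] 3 by (simp add: homog_def)
      qed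
    qed
    then show "T2 \<mu> = \<mu>"
      using hom[of 0 0] P_star_rho_prob_algebra[OF P]
      by (intro corner_measure_eqI T2_in_prob_algebra) (auto simp: F_def homog_def)
  qed
qed

text \<open>Here f is only known to be continuous. Completing the square gives (f - x/2)^2 = Q,
  where Q is differentiable as it involves only the integral of f and powers of x. On [0,1) the
  bound f \<ge> 1/2 > x/2 selects the positive root, and f = x/2 + sqrt Q becomes
  differentiable.\<close>

lemma integral_equation_imp_cauchy_solution:
  fixes f :: "real \<Rightarrow> real" defines "\<Phi> \<equiv> \<lambda>x. integral {0..x} f"
  assumes cont: "continuous_on {0..1} f" and f0: "f 0 = 1 / 2" and ge: "\<And>x. x \<in> {0..1} \<Longrightarrow> 1 / 2 \<le> f x"
    and eq: "\<And>x. x \<in> {0..1} \<Longrightarrow>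
      (f x)\<^sup>2 = (1 + x\<^sup>2) / 4 + x * f x - x\<^sup>2 * \<Phi> 1 - \<Phi> x + x\<^sup>2 / 2 * f 1"
  obtains c where "0 \<le> c" "cauchy_solution c (restrict f {0..1})" "(f 1)\<^sup>2 - f 1 / 2 = 2 * c"
proof
  \<comment> \<open>All coefficients of x^2 outside the term x^2 / 4 of the completed square; with
    this name the equation at x = 1 is the end condition.\<close>
  define c where "c = 1 / 4 - \<Phi> 1 + f 1 / 2"
  have eq': "(f x)\<^sup>2 - x * f x = 1 / 4 - \<Phi> x + c * x\<^sup>2" if "x \<in> {0..1}" for x
    using eq[OF that] by (simp add: c_def algebra_simps)
  show c2: "(f 1)\<^sup>2 - f 1 / 2 = 2 * c"
    using eq'[of 1] by (simp add: c_def)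
  have "(f 1)\<^sup>2 - f 1 / 2 = f 1 * (f 1 - 1 / 2)" by (simp add: power2_eq_square algebra_simps)
  also have "0 \<le> \<dots>" using ge[of 1] by (intro mult_nonneg_nonneg) auto
  finally show "0 \<le> c" using c2 by simp
  define Q where "Q x = x\<^sup>2 / 4 + 1 / 4 - \<Phi> x + c * x\<^sup>2" for x
  have Q: "Q x = (f x - x / 2)\<^sup>2" if "x \<in> {0..1}" for x
    using eq'[OF that] by (simp add: Q_def power2_eq_square algebra_simps)
  have D\<Phi>: "(\<Phi> has_real_derivative f x) (at x within {0..1})" if "x \<in> {0..1}" for x
    unfolding \<Phi>_def using cont that by (rule integral_has_real_derivative)
  show "cauchy_solution c (restrict f {0..1})"
    unfolding cauchy_solution_def
  proof (intro conjI ballI)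
    show "continuous_on {0..1} (restrict f {0..1})"
      using cont by (subst continuous_on_cong[OF refl, where g=f]) auto
    show "restrict f {0..1} 0 = 1 / 2" using f0 by simp
    fix r :: real assume r: "r \<in> {0..<1}"
    have pos: "0 < f r - r / 2" using ge[of r] r by simp
    then show "restrict f {0..1} r \<noteq> r / 2" using r by simp
    have DQ: "(Q has_real_derivative r / 2 - f r + 2 * c * r) (at r within {0..1})"
      unfolding Q_def[abs_def] using r by (auto intro!: derivative_eq_intros D\<Phi>)
    have "0 < Q r" using Q[of r] pos r by simp
    then have "((\<lambda>x. sqrt (Q x)) has_real_derivative
        (r / 2 - f r + 2 * c * r) * (inverse (sqrt (Q r)) / 2)) (at r within {0..1})"
      using DERIV_chain2[where f=sqrt and g=Q and x=r, OF DERIV_real_sqrt DQ] by (simp add: mult.commute)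
    from DERIV_add[OF DERIV_cdivide[OF DERIV_ident] this, of 2]
    have "((\<lambda>x. x / 2 + sqrt (Q x)) has_real_derivative
        1 / 2 + (r / 2 - f r + 2 * c * r) * (inverse (sqrt (Q r)) / 2)) (at r within {0..1})" .
    moreover have "1 / 2 + (r / 2 - f r + 2 * c * r) * (inverse (sqrt (Q r)) / 2) = c * r / (f r - r / 2)"
    proof -
      have "sqrt (Q r) = f r - r / 2" using Q[of r] r pos by simp
      moreover have "1 / 2 + (- p + 2 * k) * (inverse p / 2) = k / p" if "p \<noteq> 0" for p k :: real
        using that by (simp add: field_simps)
      from this[of "f r - r / 2" "c * r"] have "1 / 2 + (- (f r - r / 2) + 2 * (c * r)) * (inverse (f r - r / 2) / 2) = c * r / (f r - r / 2)"
        using pos by simp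
      ultimately show ?thesis by (simp add: mult.assoc)
    qed
    ultimately have DD: "((\<lambda>x. x / 2 + sqrt (Q x)) has_real_derivative c * r / (f r - r / 2)) (at r within {0..1})"
      by simp
    have EQ: "x / 2 + sqrt (Q x) = restrict f {0..1} x" if "x \<in> {0..1}" for x
      using Q[OF that] ge[OF that] that by simp
    have "(restrict f {0..1} has_real_derivative c * r / (f r - r / 2)) (at r within {0..1})"
      by (rule has_field_derivative_transform_within[OF DD, of 1]) (use r in \<open>auto simp: EQ\<close>)
    then show "(restrict f {0..1} has_real_derivative c * r / (restrict f {0..1} r - r / 2)) (at r within {0..1})"
      using r by simp
  qed simp
qed

text \<open>\<open>H\<close> is a first integral of the Cauchy problem, constant up to x = 1 by
  continuity. The end condition then identifies c with the coefficient that the integral equation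
  demands.\<close>

lemma cauchy_solution_imp_integral_equation:
  fixes f :: "real \<Rightarrow> real" defines "\<Phi> \<equiv> \<lambda>x. integral {0..x} f"
  assumes f: "cauchy_solution c f" and c: "(f 1)\<^sup>2 - f 1 / 2 = 2 * c" and x: "x \<in> {0..1}"
  shows "(f x)\<^sup>2 = (1 + x\<^sup>2) / 4 + x * f x - x\<^sup>2 * \<Phi> 1 - \<Phi> x + x\<^sup>2 / 2 * f 1"
proof -
  have cont: "continuous_on {0..1} f" and f0: "f 0 = 1 / 2" using f by (auto simp: cauchy_solution_def)
  have D\<Phi>: "(\<Phi> has_real_derivative f x) (at x within {0..1})" if "x \<in> {0..1}" for x
    unfolding \<Phi>_def using cont that by (rule integral_has_real_derivative)
  define H where "H x = (f x)\<^sup>2 - x * f x + \<Phi> x - c * x\<^sup>2" for x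
  have contH: "continuous_on {0..1} H"
  proof -
    have "continuous_on {0..1} \<Phi>" using D\<Phi> by (rule DERIV_continuous_on)
    then show ?thesis unfolding H_def[abs_def] using cont by (intro continuous_intros)
  qed
  have H: "H y = 1 / 4" if y: "0 \<le> y" "y \<le> 1" for y
  proof (cases "y = 0")
    case True
    then show ?thesis by (simp add: H_def f0 \<Phi>_def power2_eq_square)
  next
    case False
    have "H y = H 0"
    proof (rule DERIV_isconst_end[where f=H])
      show "0 < y" using False y by simp
      show "continuous_on {0..y} H" using contH by (rule continuous_on_subset) (use y in auto)
      fix r assume "0 < r" "r < y"
      then have r: "0 < r" "r < 1" using y by auto
      have at: "at r within {0..1} = at r" using r by (simp add: at_within_Icc_at)
      define d where "d = c * r / (f r - r / 2)"
      have "(f has_real_derivative d) (at r)" "f r \<noteq> r / 2"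
        using f r by (auto simp: cauchy_solution_def at[symmetric] d_def)
      moreover have "(\<Phi> has_real_derivative f r) (at r)" using D\<Phi>[of r] r by (simp add: at)
      ultimately have "(H has_real_derivative 2 * (f r - r / 2) * d - 2 * c * r) (at r)"
        unfolding H_def[abs_def] by (auto intro!: derivative_eq_intros simp: algebra_simps)
      moreover have "(f r - r / 2) * d = c * r" using \<open>f r \<noteq> r / 2\<close> by (simp add: d_def)
      then have "2 * (f r - r / 2) * d - 2 * c * r = 0" by (simp only: mult.assoc)
      ultimately show "(H has_real_derivative 0) (at r)" by metis
    qed
    then show ?thesis by (simp add: H_def f0 \<Phi>_def power2_eq_square)
  qed
  have c': "c = 1 / 4 - \<Phi> 1 + f 1 / 2" using H[of 1] c by (simp add: H_def)
  have "(f x)\<^sup>2 = 1 / 4 + x * f x - \<Phi> x + c * x\<^sup>2" using H[of x] x by (simp add: H_def)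
  then show ?thesis unfolding c' by (simp add: algebra_simps)
qed

section \<open>The second fixed point\<close>

text \<open>Values outside [0,1] go to \<infinity>, so a larger coordinate t / y that exceeds 1
  lands there by itself.\<close>

definition real_to_I :: "real \<Rightarrow> ereal" where
  "real_to_I x = (if 0 \<le> x \<and> x \<le> 1 then ereal x else \<infinity>)"

lemma real_to_I_measurable [measurable]: "real_to_I \<in> borel \<rightarrow>\<^sub>M I_meas"
  unfolding I_meas_def
  by (rule measurable_restrict_space2)
    (auto simp: I_set_def real_to_I_def[abs_def] one_ereal_def zero_ereal_def)

lemma real_to_I_in: "real_to_I x \<in> I_set"
  by (auto simp: I_set_def real_to_I_def one_ereal_def zero_ereal_def)

lemma real_to_I_Icc: "r \<le> 1 \<Longrightarrow> real_to_I x \<in> {0..ereal r} \<longleftrightarrow> 0 \<le> x \<and> x \<le> r"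
  by (auto simp: real_to_I_def)

lemma measure_uniform_Icc:
  assumes "0 \<le> a" "a \<le> 1"
  shows "measure (uniform_measure lborel {0..1::real}) {0..a} = a"
proof -
  have "{0..1} \<inter> {0..a} = {0..a}" using assms by auto
  then show ?thesis using assms by (subst measure_uniform_measure) auto
qed

section \<open>A measure with a given convex profile\<close>

context
  fixes f d e :: "real \<Rightarrow> real"
  assumes df: "\<And>x. x \<in> {0..1} \<Longrightarrow> (f has_real_derivative d x) (at x within {0..1})"
    and dd: "\<And>x. x \<in> {0..1} \<Longrightarrow> (d has_real_derivative e x) (at x within {0..1})"
    and cont_e: "continuous_on {0..1} e"
    and e0: "\<And>x. x \<in> {0..1} \<Longrightarrow> 0 \<le> e x"
    and d0: "d 0 = 0" and d1: "2 * d 1 = f 1" and f1: "f 1 \<le> 1"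
begin

text \<open>Closed form of the mass of \<open>corner r s\<close> under the part whose second
  coordinate is the smaller one; d and e are the first two derivatives of the profile.\<close>

definition J :: "real \<Rightarrow> real \<Rightarrow> real" where
  "J r s = (if s \<le> r then r * d 1 - r * f 1 + r * f (s / r) else s * d 1)"

text \<open>The maximum switches at y = s/r. Below that point \<open>d\<close> times s is an
  antiderivative, above it r (y d y - f y).\<close>

lemma has_integral_max:
  assumes "0 \<le> r" "0 \<le> s"
  shows "((\<lambda>y. e y * max s (r * y)) has_integral J r s) {0..1}"
proof -
  have const: "((\<lambda>y. e y * k) has_integral (d b * k - d a * k)) {a..b}" if "0 \<le> a" "a \<le> b" "b \<le> 1" for a b k
  proof (rule fundamental_theorem_of_calculus)
    fix x assume "x \<in> {a..b}"
    then have "(d has_real_derivative e x) (at x within {a..b})"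
      using that by (intro DERIV_subset[OF dd]) auto
    from DERIV_cmult_right[OF this, of k]
    show "((\<lambda>x. d x * k) has_vector_derivative e x * k) (at x within {a..b})"
      by (simp add: has_real_derivative_iff_has_vector_derivative)
  qed (fact that(2))
  have lin: "((\<lambda>y. e y * (r * y)) has_integral (r * (b * d b - f b) - r * (a * d a - f a))) {a..b}"
    if "0 \<le> a" "a \<le> b" "b \<le> 1" for a b
  proof (rule fundamental_theorem_of_calculus)
    fix x assume x: "x \<in> {a..b}"
    then have "(d has_real_derivative e x) (at x within {a..b})" "(f has_real_derivative d x) (at x within {a..b})"
      using that by (auto intro!: DERIV_subset[OF dd] DERIV_subset[OF df])
    then have "((\<lambda>x. r * (x * d x - f x)) has_real_derivative r * (1 * d x + e x * x - d x)) (at x within {a..b})"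
      by (intro DERIV_cmult DERIV_diff DERIV_mult DERIV_ident)
    then show "((\<lambda>x. r * (x * d x - f x)) has_vector_derivative e x * (r * x)) (at x within {a..b})"
      by (simp add: has_real_derivative_iff_has_vector_derivative mult_ac)
  qed (fact that(2))
  show ?thesis
  proof (cases "s \<le> r \<and> 0 < r")
    case True
    define x where "x = s / r"
    have x: "0 \<le> x" "x \<le> 1" "s = r * x" using True assms by (auto simp: x_def)
    have "((\<lambda>y. e y * max s (r * y)) has_integral (d x * s - d 0 * s)) {0..x}"
      by (rule has_integral_eq[OF _ const]) (use x True in \<open>auto simp: max_def mult_left_mono\<close>)
    moreover have "((\<lambda>y. e y * max s (r * y)) has_integral (r * (1 * d 1 - f 1) - r * (x * d x - f x))) {x..1}"
      by (rule has_integral_eq[OF _ lin]) (use x True in \<open>auto simp: max_def\<close>)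
    ultimately have "((\<lambda>y. e y * max s (r * y)) has_integral
        ((d x * s - d 0 * s) + (r * (1 * d 1 - f 1) - r * (x * d x - f x)))) {0..1}"
      using x by (intro has_integral_combine[of 0 x 1]) auto
    moreover have "(d x * s - d 0 * s) + (r * (1 * d 1 - f 1) - r * (x * d x - f x)) = J r s"
      unfolding J_def x_def[symmetric] using True by (simp add: d0 x(3) algebra_simps)
    ultimately show ?thesis by simp
  next
    case False
    then have "s = 0 \<and> r = 0 \<or> r < s" using assms by auto
    moreover have "max s (r * y) = s" if "y \<in> {0..1}" "r \<le> s" for y
      using that assms mult_left_mono[of y 1 r] by (auto simp: max_def)
    ultimately have "((\<lambda>y. e y * max s (r * y)) has_integral (d 1 * s - d 0 * s)) {0..1}"
      by (intro has_integral_eq[OF _ const]) auto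
    moreover have "d 1 * s - d 0 * s = J r s"
      using \<open>s = 0 \<and> r = 0 \<or> r < s\<close> by (auto simp: J_def d0)
    ultimately show ?thesis by simp
  qed
qed

text \<open>The surplus r (2 d 1 - f 1) vanishes by the condition on d 1. If 2 d 1 were smaller than
  f 1, the difference would have to be placed on the diagonal.\<close>

lemma J_sum: "0 \<le> r \<Longrightarrow> 0 \<le> s \<Longrightarrow> J r s + J s r = homog f r s"
proof -
  have *: "J r s + J s r = homog f r s" if "0 \<le> s" "s \<le> r" for r s
  proof (cases "s = r")
    case True
    then show ?thesis using that d1 by (cases "r = 0") (auto simp: J_def homog_def algebra_simps)
  next
    case False
    then have "J r s + J s r = r * (2 * d 1 - f 1) + r * f (s / r)"
      using that by (simp add: J_def algebra_simps)
    then show ?thesis using d1 that by (simp add: homog_le)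
  qed
  show "0 \<le> r \<Longrightarrow> 0 \<le> s \<Longrightarrow> J r s + J s r = homog f r s"
    using *[of s r] *[of r s] homog_commute[of f r s] by (cases "s \<le> r") auto
qed

text \<open>
  A point y in [-1,1] carries the ratio |y| of the two coordinates, its sign telling which of them is
  the smaller one; (1,2] carries the mass at (\<infinity>,\<infinity>).
\<close>

definition weight :: "real \<Rightarrow> real" where
  "weight y = (if y \<in> {-1..<0} then e (- y) else if y \<in> {0..1} then e y
     else if y \<in> {1<..2} then 1 - f 1 else 0)"

lemma weight_nonneg: "0 \<le> weight y"
  using e0 f1 by (auto simp: weight_def)

lemma weight_measurable [measurable]: "weight \<in> borel_measurable borel"
proof -
  have "(\<lambda>y. if y \<in> {0..1} then e y else 0) \<in> borel_measurable borel"
    using cont_e by (intro borel_measurable_continuous_on_if) auto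
  moreover have "(\<lambda>y. if y \<in> {-1..<0} then e (- y) else 0) \<in> borel_measurable borel"
    by (intro borel_measurable_continuous_on_if continuous_on_compose2[OF cont_e]) (auto intro!: continuous_intros)
  ultimately have "(\<lambda>y. (if y \<in> {-1..<0} then e (- y) else 0) + (if y \<in> {0..1} then e y else 0)
     + (if y \<in> {1<..2} then 1 - f 1 else 0)) \<in> borel_measurable borel"
    by (intro borel_measurable_add) auto
  also have "(\<lambda>y. (if y \<in> {-1..<0} then e (- y) else 0) + (if y \<in> {0..1} then e y else 0)
     + (if y \<in> {1<..2} then 1 - f 1 else 0)) = weight"
    by (auto simp: weight_def fun_eq_iff)
  finally show ?thesis .
qed

text \<open>Integrals ignore the breakpoints, so h is constrained only inside the three
  pieces.\<close>

lemma has_integral_weight: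
  assumes "((\<lambda>y. e y * g1 y) has_integral A) {0..1}" "((\<lambda>y. e y * g2 y) has_integral B) {0..1}"
    and "\<And>y. 0 < y \<Longrightarrow> y < 1 \<Longrightarrow> h y = g1 y" "\<And>y. 0 < y \<Longrightarrow> y < 1 \<Longrightarrow> h (- y) = g2 y"
    and "\<And>y. 1 < y \<Longrightarrow> y < 2 \<Longrightarrow> h y = k"
  shows "((\<lambda>y. weight y * h y) has_integral (B + A + (1 - f 1) * k)) UNIV"
proof -
  have 1: "((\<lambda>y. weight y * h y) has_integral A) {0..1}"
    using has_integral_spike_interior[of "\<lambda>y. e y * g1 y" A 0 1 "\<lambda>y. weight y * h y"] assms(1,3)
    by (auto simp: weight_def)
  have "((\<lambda>y. e (- y) * g2 (- y)) has_integral B) {-1..0}"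
    using has_integral_reflect_real[of "\<lambda>y. e y * g2 y" B 1 0] assms(2) by simp
  moreover have "weight y * h y = e (- y) * g2 (- y)" if "- 1 < y" "y < 0" for y
    using assms(4)[of "- y"] that by (simp add: weight_def)
  ultimately have 2: "((\<lambda>y. weight y * h y) has_integral B) {-1..0}"
    using has_integral_spike_interior[of "\<lambda>y. e (- y) * g2 (- y)" B "-1" 0 "\<lambda>y. weight y * h y"] by auto
  have "((\<lambda>y. (1 - f 1) * k) has_integral (1 - f 1) * k) {1..2::real}"
    using has_integral_const_real[of "(1 - f 1) * k" 1 2] by simp
  moreover have "weight y * h y = (1 - f 1) * k" if "1 < y" "y < 2" for y
    using assms(5)[of y] that by (simp add: weight_def)
  ultimately have 3: "((\<lambda>y. weight y * h y) has_integral (1 - f 1) * k) {1..2}"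
    using has_integral_spike_interior[of "\<lambda>y. (1 - f 1) * k" "(1 - f 1) * k" 1 2 "\<lambda>y. weight y * h y"] by auto
  have "((\<lambda>y. weight y * h y) has_integral (B + A + (1 - f 1) * k)) {-1..2}"
    by (rule has_integral_combine[OF _ _ has_integral_combine[OF _ _ 2 1] 3]) auto
  then show ?thesis
    by (rule has_integral_on_superset) (auto simp: weight_def)
qed

text \<open>Given a ratio y in (0,1), the uniform smaller coordinate t puts the pair into the corner
  exactly for 0 \<le> t \<le> \<open>max s (r * y)\<close>, or with r and s exchanged on the other
  side. The total mass is 2 d 1 + (1 - f 1) = 1.\<close>

lemma homog_measure_exists:
  obtains \<mu> where "\<mu> \<in> space (prob_algebra I2_meas)"
    "\<And>r s. 0 \<le> r \<Longrightarrow> r \<le> 1 \<Longrightarrow> 0 \<le> s \<Longrightarrow> s \<le> 1 \<Longrightarrow> measure \<mu> (corner r s) = homog f r s"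
proof -
  define U where "U = uniform_measure lborel {0..1::real}"
  define N where "N = density lborel (\<lambda>y. ennreal (weight y))"
  \<comment> \<open>At y = 0 this relies on t / 0 = 0, which is harmless because {0} is null for
    \<open>N\<close>.\<close>
  define h where "h = (\<lambda>(t, y). if y < 0 then (real_to_I t, real_to_I (t / - y))
    else if y \<le> 1 then (real_to_I (t / y), real_to_I t) else (\<infinity>, \<infinity>))"
  interpret U: prob_space U unfolding U_def by (rule prob_space_uniform_measure) auto
  interpret N: prob_space N
  proof
    have "((\<lambda>y. e y * 1) has_integral (d 1 - d 0)) {0..1}"
      using fundamental_theorem_of_calculus[of 0 1 d e] dd
      by (simp add: has_real_derivative_iff_has_vector_derivative)
    from has_integral_weight[OF this this, of "\<lambda>_. 1" 1]
    have "(weight has_integral 1) UNIV" using d0 d1 by simp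
    from nn_integral_has_integral_lborel[OF weight_measurable weight_nonneg this]
    show "emeasure N (space N) = 1" by (simp add: N_def emeasure_density)
  qed
  interpret UN: pair_prob_space U N ..
  have sets: "sets (U \<Otimes>\<^sub>M N) = sets (borel \<Otimes>\<^sub>M borel)"
    by (intro sets_pair_measure_cong) (simp_all add: U_def N_def)
  have h: "h \<in> U \<Otimes>\<^sub>M N \<rightarrow>\<^sub>M I2_meas"
  proof -
    have inf: "(\<lambda>_. \<infinity>) \<in> M \<rightarrow>\<^sub>M I_meas" for M :: "(real \<times> real) measure"
      by (rule measurable_const) (simp add: space_I_meas I_set_def)
    note [measurable] = inf
    have "h \<in> borel \<Otimes>\<^sub>M borel \<rightarrow>\<^sub>M I2_meas"
      unfolding h_def I2_meas_def by measurable
    then show ?thesis using measurable_cong_sets[OF sets refl] by blast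
  qed
  define \<mu> where "\<mu> = distr (U \<Otimes>\<^sub>M N) I2_meas h"
  have "\<mu> \<in> space (prob_algebra I2_meas)"
    using UN.prob_space_distr[OF h] by (simp add: \<mu>_def space_prob_algebra)
  moreover have "measure \<mu> (corner r s) = homog f r s" if r: "0 \<le> r" "r \<le> 1" and s: "0 \<le> s" "s \<le> 1" for r s
  proof -
    define X where "X = h -` corner r s \<inter> space (U \<Otimes>\<^sub>M N)"
    have X: "X \<in> sets (U \<Otimes>\<^sub>M N)"
      unfolding X_def using h corner_sets r s by (intro measurable_sets) auto
    have corner_iff: "(real_to_I a, real_to_I b) \<in> corner r s \<longleftrightarrow> (0 \<le> a \<and> a \<le> r) \<or> (0 \<le> b \<and> b \<le> s)" for a b
      using real_to_I_Icc[of r a] real_to_I_Icc[of s b] real_to_I_in r s by (auto simp: corner_def)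
    define m where "m y = measure U ((\<lambda>t. (t, y)) -` X)" for y
    have m0: "0 \<le> m y" for y by (simp add: m_def)
    have sl: "(\<lambda>t. (t, y)) -` X = {t. h (t, y) \<in> corner r s}" for y
      by (auto simp: X_def space_pair_measure U_def N_def)
    have m1: "m y = max s (r * y)" if "0 < y" "y < 1" for y
    proof -
      have "(\<lambda>t. (t, y)) -` X = {0..max s (r * y)}"
        unfolding sl using that r s by (auto simp: h_def corner_iff field_simps)
      moreover have "max s (r * y) \<le> 1" using that r s by (simp add: mult_le_one)
      ultimately show ?thesis unfolding m_def U_def using s by (simp add: measure_uniform_Icc)
    qed
    have m2: "m (- y) = max r (s * y)" if "0 < y" "y < 1" for y
    proof -
      have "(\<lambda>t. (t, - y)) -` X = {0..max r (s * y)}"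
        unfolding sl using that r s by (auto simp: h_def corner_iff field_simps)
      moreover have "max r (s * y) \<le> 1" using that r s by (simp add: mult_le_one)
      ultimately show ?thesis unfolding m_def U_def using r by (simp add: measure_uniform_Icc)
    qed
    have m3: "m y = 0" if "1 < y" "y < 2" for y
      unfolding m_def sl using that by (simp add: h_def corner_def)
    have mm: "m \<in> borel_measurable borel"
    proof -
      have "(\<lambda>y. emeasure U ((\<lambda>t. (t, y)) -` X)) \<in> borel_measurable N"
        by (rule UN.measurable_emeasure_Pair2[OF X])
      then have "(\<lambda>y. enn2real (emeasure U ((\<lambda>t. (t, y)) -` X))) \<in> borel_measurable N"
        by (rule borel_measurable_enn2real)
      then show ?thesis by (simp add: m_def[abs_def] measure_def N_def cong: measurable_cong_sets)
    qed
    have "emeasure \<mu> (corner r s) = emeasure (U \<Otimes>\<^sub>M N) X"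
      unfolding \<mu>_def X_def using corner_sets r s by (intro emeasure_distr[OF h]) auto
    also have "\<dots> = (\<integral>\<^sup>+y. ennreal (m y) \<partial>N)"
      unfolding m_def U.emeasure_eq_measure[symmetric] by (rule UN.emeasure_pair_measure_alt2[OF X])
    also have "\<dots> = (\<integral>\<^sup>+y. ennreal (weight y * m y) \<partial>lborel)"
      unfolding N_def using mm
      by (subst nn_integral_density) (auto simp: ennreal_mult weight_nonneg m0)
    also have "\<dots> = ennreal (J s r + J r s + (1 - f 1) * 0)"
    proof (rule nn_integral_has_integral_lborel)
      show "((\<lambda>y. weight y * m y) has_integral (J s r + J r s + (1 - f 1) * 0)) UNIV"
        by (rule has_integral_weight[OF has_integral_max[OF r(1) s(1)] has_integral_max[OF s(1) r(1)]])
          (use m1 m2 m3 in auto)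
      show "(\<lambda>y. weight y * m y) \<in> borel_measurable borel" using mm by measurable
    qed (simp add: weight_nonneg m_def)
    finally have "emeasure \<mu> (corner r s) = ennreal (homog f r s)"
      using J_sum[OF r(1) s(1)] by (simp add: add.commute)
    \<comment> \<open>Needed to return from extended nonnegative reals; it follows since e \<ge> 0
      makes both integrals nonnegative.\<close>
    moreover have "0 \<le> homog f r s"
    proof -
      have "0 \<le> J r s" if "0 \<le> r" "0 \<le> s" for r s
        using has_integral_nonneg[OF has_integral_max[OF that]] e0 that by (auto simp: le_max_iff_disj)
      then show ?thesis using J_sum[OF r(1) s(1)] r s by (metis add_nonneg_nonneg)
    qed
    ultimately show ?thesis by (simp add: measure_def)
  qed
  ultimately show ?thesis by (rule that)
qed

end

section \<open>Fixed points and profiles\<close>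

lemma rho_bar2_corner:
  shows "rho_bar2 \<in> space (prob_algebra I2_meas)"
    and "0 \<le> r \<Longrightarrow> r \<le> 1 \<Longrightarrow> 0 \<le> s \<Longrightarrow> s \<le> 1 \<Longrightarrow> measure rho_bar2 (corner r s) = homog (f_sol 0) r s"
proof -
  interpret R: prob_space rho by (rule prob_space_rho)
  have sp: "space rho = I_set" using sets_eq_imp_space_eq[OF sets_rho] by (simp add: space_I_meas)
  have m: "(\<lambda>y. (y, y)) \<in> rho \<rightarrow>\<^sub>M I2_meas"
    unfolding I2_meas_def measurable_cong_sets[OF sets_rho refl] by measurable
  show "rho_bar2 \<in> space (prob_algebra I2_meas)"
    using R.prob_space_distr[OF m] by (simp add: rho_bar2_def space_prob_algebra)
  assume rs: "0 \<le> r" "r \<le> 1" "0 \<le> s" "s \<le> 1"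
  have "(\<lambda>y. (y, y)) -` corner r s \<inter> space rho = {0..ereal (max r s)}"
  proof -
    have "{0..ereal r} \<union> {0..ereal s} = {0..ereal (max r s)}"
    proof (cases "r \<le> s")
      case True
      then have "{0..ereal r} \<subseteq> {0..ereal s}" by simp
      then show ?thesis using True by (simp add: max_absorb2 Un_absorb1)
    next
      case False
      then have "{0..ereal s} \<subseteq> {0..ereal r}" by simp
      then show ?thesis using False by (simp add: max_absorb1 Un_absorb2)
    qed
    then show ?thesis
      using rs Icc_subset_I_set[of r] Icc_subset_I_set[of s] unfolding sp corner_def by blast
  qed
  then have "measure rho_bar2 (corner r s) = max r s / 2"
    unfolding rho_bar2_def using rs rho_Icc[of "max r s"] by (subst measure_distr[OF m corner_sets]) auto
  moreover have f0: "f_sol 0 (min r s / max r s) = 1 / 2"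
    using rs by (intro f_sol_0) (auto simp: divide_le_eq_1 min_def max_def)
  ultimately show "measure rho_bar2 (corner r s) = homog (f_sol 0) r s"
    unfolding homog_def f0 by simp
qed

text \<open>The second derivative has the sign of f - x f', and (f - x/2) (f - x f') = (f + p x) (f
  - (p + 1/2) x) > 0. The end condition gives f'(1) = c / (f 1 - 1/2) = f 1 / 2, and f 1 > 1 would
  give 2 c \<ge> 1/2.\<close>

lemma end_condition_measure_exists:
  assumes c: "0 < c" "c < 1/4" and cond: "(f_sol c 1)\<^sup>2 - f_sol c 1 / 2 = 2 * c"
  obtains \<mu> where "\<mu> \<in> space (prob_algebra I2_meas)"
    "\<And>r s. 0 \<le> r \<Longrightarrow> r \<le> 1 \<Longrightarrow> 0 \<le> s \<Longrightarrow> s \<le> 1 \<Longrightarrow> measure \<mu> (corner r s) = homog (f_sol c) r s"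
proof -
  obtain p T f where p: "c = p * (p + 1/2)" and sol: "cauchy_solution c f"
    and half: "\<And>x. 0 \<le> x \<Longrightarrow> x \<le> 1 \<Longrightarrow> x / 2 < f x"
    and pos: "\<And>x. 0 \<le> x \<Longrightarrow> x \<le> 1 \<Longrightarrow> 0 < (f x + p * x) * (f x - (p + 1/2) * x)"
    and df: "\<And>x. 0 \<le> x \<Longrightarrow> x \<le> 1 \<Longrightarrow> (f has_real_derivative (c * x / (f x - x / 2))) (at x within {0..1})"
    by (rule cauchy_solution_param[OF c(1)]) (rule that; assumption)
  have f: "f_sol c = f" using f_sol_eq[OF _ sol] c by simp
  have f1: "f 1 * (f 1 - 1 / 2) = 2 * c" using cond by (simp add: f power2_eq_square algebra_simps)
  define d where "d x = c * x / (f x - x / 2)" for x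
  define e where "e x = c * (f x - x * d x) / (f x - x / 2)\<^sup>2" for x
  have df': "(f has_real_derivative d x) (at x within {0..1})" if "x \<in> {0..1}" for x
    using df[of x] that by (simp add: d_def)
  have dd: "(d has_real_derivative e x) (at x within {0..1})" if x: "x \<in> {0..1}" for x
  proof -
    have ne: "f x - x / 2 \<noteq> 0" using half[of x] x by simp
    have "((\<lambda>x. c * x) has_real_derivative c) (at x within {0..1})"
      "((\<lambda>x. f x - x / 2) has_real_derivative d x - 1 / 2) (at x within {0..1})"
      by (auto intro!: derivative_eq_intros df'[OF x])
    from DERIV_divide[OF this ne]
    have "(d has_real_derivative (c * (f x - x / 2) - c * x * (d x - 1 / 2)) / ((f x - x / 2) * (f x - x / 2))) (at x within {0..1})"
      unfolding d_def[abs_def] by simp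
    moreover have "(c * (f x - x / 2) - c * x * (d x - 1 / 2)) / ((f x - x / 2) * (f x - x / 2)) = e x"
      by (simp add: e_def power2_eq_square algebra_simps)
    ultimately show ?thesis by simp
  qed
  have cont: "continuous_on {0..1} f" "continuous_on {0..1} d"
    by (rule DERIV_continuous_on, erule df') (rule DERIV_continuous_on, erule dd)
  have "continuous_on {0..1} e"
  proof -
    have "f x - x / 2 \<noteq> 0" if "x \<in> {0..1}" for x using half[of x] that by simp
    then show ?thesis unfolding e_def[abs_def] by (intro continuous_intros cont) auto
  qed
  moreover have "0 \<le> e x" if x: "x \<in> {0..1}" for x
  proof -
    have h: "0 < f x - x / 2" using half[of x] x by simp
    have "(f x - x / 2) * (f x - x * d x) = (f x - x / 2) * f x - x * ((f x - x / 2) * d x)"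
      by (simp add: algebra_simps)
    also have "(f x - x / 2) * d x = c * x" using h by (simp add: d_def)
    also have "(f x - x / 2) * f x - x * (c * x) = (f x + p * x) * (f x - (p + 1/2) * x)"
      by (simp add: p algebra_simps)
    finally have "0 < (f x - x / 2) * (f x - x * d x)" using pos[of x] x by simp
    then have "0 < f x - x * d x" using h zero_less_mult_pos by blast
    then show ?thesis using c by (simp add: e_def)
  qed
  moreover have "d 0 = 0" by (simp add: d_def)
  moreover have "2 * d 1 = f 1" using f1 half[of 1] by (simp add: d_def field_simps)
  moreover have "f 1 \<le> 1"
  proof (rule ccontr)
    assume "\<not> f 1 \<le> 1"
    then have "1 * (1 / 2) \<le> f 1 * (f 1 - 1 / 2)" by (intro mult_mono) auto
    then show False using f1 c by simp
  qed
  ultimately show ?thesis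
    using homog_measure_exists[OF df' dd, of thesis] that unfolding f by blast
qed

lemma profile_imp_fixed_point:
  assumes c: "0 \<le> c" and cond: "(f_sol c 1)\<^sup>2 - f_sol c 1 / 2 = 2 * c"
    and \<mu>: "\<mu> \<in> space (prob_algebra I2_meas)"
    and F: "\<And>r s. 0 \<le> r \<Longrightarrow> r \<le> 1 \<Longrightarrow> 0 \<le> s \<Longrightarrow> s \<le> 1 \<Longrightarrow> measure \<mu> (corner r s) = homog (f_sol c) r s"
  shows "\<mu> \<in> P_star_rho" "T2 \<mu> = \<mu>"
proof -
  note sol = cauchy_solution_f_sol[OF c]
  then have "f_sol c 0 = 1 / 2" by (simp add: cauchy_solution_def)
  from in_P_star_rho[OF \<mu> F this] show P: "\<mu> \<in> P_star_rho" .
  have F1: "measure \<mu> (corner 1 x) = f_sol c x" if "x \<in> {0..1}" for x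
    using F[of 1 x] that by (simp add: homog_le)
  have "integral {0..x} (\<lambda>x. measure \<mu> (corner 1 x)) = integral {0..x} (f_sol c)" if "x \<in> {0..1}" for x
    using F1 that by (intro integral_cong) auto
  then show "T2 \<mu> = \<mu>"
    unfolding fixed_point_iff[OF P]
    using cauchy_solution_imp_integral_equation[OF sol cond] F1 by simp
qed

lemma fixed_point_imp_profile:
  assumes P: "\<mu> \<in> P_star_rho" and fp: "T2 \<mu> = \<mu>"
  obtains c where "0 \<le> c" "(f_sol c 1)\<^sup>2 - f_sol c 1 / 2 = 2 * c"
    "\<And>r s. 0 \<le> r \<Longrightarrow> r \<le> 1 \<Longrightarrow> 0 \<le> s \<Longrightarrow> s \<le> 1 \<Longrightarrow> measure \<mu> (corner r s) = homog (f_sol c) r s"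
proof -
  define f where "f x = measure \<mu> (corner 1 x)" for x
  have f0: "f 0 = 1 / 2" using corner_axis[OF P, of 1] by (simp add: f_def)
  have "continuous_on {0..1} ((\<lambda>(r, s). measure \<mu> (corner r s)) \<circ> (\<lambda>s. (1, s)))"
    by (rule continuous_on_compose)
      (auto intro!: continuous_intros continuous_on_subset[OF corner_measure_continuous[OF P]])
  then have cont: "continuous_on {0..1} f" by (simp add: comp_def f_def[abs_def])
  \<comment> \<open>\<open>corner 1 x\<close> contains \<open>corner 1 0\<close>, whose mass is
    1/2.\<close>
  have ge: "1 / 2 \<le> f x" if "x \<in> {0..1}" for x
    using corner_measure_mono[OF P, of 1 1 0 x] that f0 by (simp add: f_def)
  have "(f x)\<^sup>2 = (1 + x\<^sup>2) / 4 + x * f x - x\<^sup>2 * integral {0..1} f - integral {0..x} f + x\<^sup>2 / 2 * f 1"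
    if "x \<in> {0..1}" for x
    using fixed_point_iff[OF P] fp that unfolding f_def[abs_def] by blast
  from integral_equation_imp_cauchy_solution[OF cont f0 ge this]
  obtain c where c: "0 \<le> c" "cauchy_solution c (restrict f {0..1})" "(f 1)\<^sup>2 - f 1 / 2 = 2 * c" .
  have fs: "f_sol c x = f x" if "x \<in> {0..1}" for x
    using f_sol_eq[OF c(1,2)] that by simp
  show ?thesis
  proof (rule that[of c])
    show "(f_sol c 1)\<^sup>2 - f_sol c 1 / 2 = 2 * c" using c fs[of 1] by simp
    fix r s :: real assume rs: "0 \<le> r" "r \<le> 1" "0 \<le> s" "s \<le> 1"
    \<comment> \<open>This covers the origin as well, since 0 / 0 = 0.\<close>
    have "min r s / max r s \<in> {0..1}" using rs by (auto simp: divide_le_eq_1 min_def max_def)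
    then have "homog (f_sol c) r s = homog f r s" using fs by (simp add: homog_def)
    then show "measure \<mu> (corner r s) = homog (f_sol c) r s"
      using corner_homog[OF P rs] by (simp add: f_def[abs_def])
  qed (fact c)
qed

theorem theorem12:
  shows "(\<forall>c\<ge>0. \<exists>!f. cauchy_solution c f) \<and>
    (\<exists>\<rho>\<^sub>1 \<rho>\<^sub>2 c\<^sub>1 c\<^sub>2.
       \<rho>\<^sub>1 \<noteq> \<rho>\<^sub>2 \<and>
       {\<mu> \<in> P_star_rho. T2 \<mu> = \<mu>} = {\<rho>\<^sub>1, \<rho>\<^sub>2} \<and>
       c\<^sub>1 < c\<^sub>2 \<and>
       {c. 0 \<le> c \<and> (f_sol c 1)\<^sup>2 - f_sol c 1 / 2 = 2 * c} = {c\<^sub>1, c\<^sub>2} \<and>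
       c\<^sub>1 = 0 \<and> 0 < c\<^sub>2 \<and> c\<^sub>2 < 1 / 4 \<and>
       (\<forall>\<mu> \<in> space (prob_algebra I2_meas). has_profile \<mu> c\<^sub>1 \<longleftrightarrow> \<mu> = \<rho>\<^sub>1) \<and>
       (\<forall>\<mu> \<in> space (prob_algebra I2_meas). has_profile \<mu> c\<^sub>2 \<longleftrightarrow> \<mu> = \<rho>\<^sub>2) \<and>
       \<rho>\<^sub>1 = rho_bar2)"
proof -
  obtain c2 where c2: "0 < c2" "c2 < 1 / 4"
    and set: "{c. 0 \<le> c \<and> (f_sol c 1)\<^sup>2 - f_sol c 1 / 2 = 2 * c} = {0, c2}"
    using end_condition_solutions by blast
  then have cond: "(f_sol 0 1)\<^sup>2 - f_sol 0 1 / 2 = 2 * 0" "(f_sol c2 1)\<^sup>2 - f_sol c2 1 / 2 = 2 * c2"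
    by blast+
  obtain \<rho>2 where \<rho>2: "\<rho>2 \<in> space (prob_algebra I2_meas)"
    "\<And>r s. 0 \<le> r \<Longrightarrow> r \<le> 1 \<Longrightarrow> 0 \<le> s \<Longrightarrow> s \<le> 1 \<Longrightarrow> measure \<rho>2 (corner r s) = homog (f_sol c2) r s"
    using end_condition_measure_exists[OF c2 cond(2)] by blast
  note \<rho>1 = rho_bar2_corner
  have profile: "has_profile \<mu> c \<longleftrightarrow> \<mu> = \<nu>"
    if "\<mu> \<in> space (prob_algebra I2_meas)" "\<nu> \<in> space (prob_algebra I2_meas)"
      "\<And>r s. 0 \<le> r \<Longrightarrow> r \<le> 1 \<Longrightarrow> 0 \<le> s \<Longrightarrow> s \<le> 1 \<Longrightarrow> measure \<nu> (corner r s) = homog (f_sol c) r s"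
    for \<mu> \<nu> c
    unfolding has_profile_iff[OF that(1)]
    using corner_measure_eqI_homog[OF that(1,2), of "f_sol c"] that(3) by auto
  \<comment> \<open>Equal measures would give f 1 = 1/2 for the second profile, and the end
    condition would then read 0 = 2 c2.\<close>
  have ne: "rho_bar2 \<noteq> \<rho>2"
  proof
    assume "rho_bar2 = \<rho>2"
    then have half: "f_sol c2 1 = 1 / 2"
      using \<rho>1(2)[of 1 1] \<rho>2(2)[of 1 1] f_sol_0[of 1] by (simp add: homog_def)
    show False using cond(2) c2 unfolding half by (simp add: power2_eq_square)
  qed
  have fp: "{\<mu> \<in> P_star_rho. T2 \<mu> = \<mu>} = {rho_bar2, \<rho>2}"
  proof (intro equalityI subsetI)
    fix \<mu> assume "\<mu> \<in> {\<mu> \<in> P_star_rho. T2 \<mu> = \<mu>}"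
    then have P: "\<mu> \<in> P_star_rho" and "T2 \<mu> = \<mu>" by auto
    from fixed_point_imp_profile[OF this] obtain c where c: "0 \<le> c"
      "(f_sol c 1)\<^sup>2 - f_sol c 1 / 2 = 2 * c"
      "\<And>r s. 0 \<le> r \<Longrightarrow> r \<le> 1 \<Longrightarrow> 0 \<le> s \<Longrightarrow> s \<le> 1 \<Longrightarrow> measure \<mu> (corner r s) = homog (f_sol c) r s"
      by blast
    then have "c \<in> {0, c2}" using set by blast
    moreover have "\<mu> = rho_bar2" if "c = 0"
      using c(3) that by (intro corner_measure_eqI_homog[OF P_star_rho_prob_algebra[OF P] \<rho>1(1) _ \<rho>1(2)]) auto
    moreover have "\<mu> = \<rho>2" if "c = c2"
      using c(3) that by (intro corner_measure_eqI_homog[OF P_star_rho_prob_algebra[OF P] \<rho>2(1) _ \<rho>2(2)]) auto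
    ultimately show "\<mu> \<in> {rho_bar2, \<rho>2}" by auto
  next
    fix \<mu> assume "\<mu> \<in> {rho_bar2, \<rho>2}"
    then show "\<mu> \<in> {\<mu> \<in> P_star_rho. T2 \<mu> = \<mu>}"
      using profile_imp_fixed_point[OF _ cond(1) \<rho>1] profile_imp_fixed_point[OF _ cond(2) \<rho>2] c2 by auto
  qed
  show ?thesis
  proof (intro conjI exI)
    show "\<forall>c\<ge>0. \<exists>!f. cauchy_solution c f" using cauchy_solution_ex1 by blast
    show "{\<mu> \<in> P_star_rho. T2 \<mu> = \<mu>} = {rho_bar2, \<rho>2}" by (rule fp)
    show "{c. 0 \<le> c \<and> (f_sol c 1)\<^sup>2 - f_sol c 1 / 2 = 2 * c} = {0, c2}" by (rule set)
    show "\<forall>\<mu>\<in>space (prob_algebra I2_meas). has_profile \<mu> 0 \<longleftrightarrow> \<mu> = rho_bar2"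
      using profile[OF _ \<rho>1] by blast
    show "\<forall>\<mu>\<in>space (prob_algebra I2_meas). has_profile \<mu> c2 \<longleftrightarrow> \<mu> = \<rho>2"
      using profile[OF _ \<rho>2] by blast
  qed (use ne c2 in auto)
qed

end
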